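(* There exists $\epsilon_0>0$ such that for every $\epsilon$ with $0<\epsilon<\epsilon_0$ there is a constant $C(\epsilon)>0$ with the following property: for all $r\in(0,1)$ there is a closed subset $E=E_{\epsilon,r}$ of $\mathbb{T}$ with $\operatorname{Cap}(E)=\epsilon$ and $$\operatorname{Cap}\bigl(E,\overline{\Delta}(0,r)\bigr)\le C(\epsilon).$$
   Context: $\Delta$ is the open unit disc in $\mathbb{C}$, $\mathbb{T}=\partial\Delta$ is the unit circle, $\overline{\Delta}=\Delta\cup\mathbb{T}$, and $\overline{\Delta}(z,r)$ is the closed disc of radius $r$ centered at $z$. For closed disjoint sets $E,F\subset\overline{\Delta}$, the capacity of the condenser $(E,F)$ in $\Delta$ is $$\operatorname{Cap}(E,F)=\inf\left\{\|\nabla u\|_{L^2(\Delta)}^2:\ u\ge1\text{ on }E,\ u\le0\text{ on }F\right\},$$ where the infimum is over real functions $u$ which are $C^1$ in $\Delta$ and such that, for each $\zeta\in(E\cup F)\setminus\Delta$, the limit $\lim_{r\to1^-}u(r\zeta)\in\mathbb{R}\cup\{+\infty\}$ exists; the value of $u$ at such a boundary point $\zeta$ is understood to be this limit. The $L^2(\Delta)$ norm is with respect to area measure. For closed $E\subseteq\mathbb{T}$ one sets $\operatorname{Cap}(E):=\operatorname{Cap}(E,\overline{\Delta}(0,1/2))$. *)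

theory Defs
  imports "HOL-Analysis.Analysis"
begin

definition gradient :: "(complex \<Rightarrow> real) \<Rightarrow> complex \<Rightarrow> complex" where
  "gradient u z = (THE D. GDERIV u z :> D)"

lemma gradient_eqI:
  assumes "GDERIV u z :> D"
  shows "gradient u z = D"
  unfolding gradient_def
proof (rule the_equality)
  fix D' assume "GDERIV u z :> D'"
  with assms have "(\<lambda>h. h \<bullet> D') = (\<lambda>h. h \<bullet> D)"
    unfolding gderiv_def by (rule has_derivative_unique[rotated])
  then have "\<forall>h. h \<bullet> D' = h \<bullet> D"
    by (simp add: fun_eq_iff)
  then show "D' = D"
    by (simp only: vector_eq_ldot)
qed (fact assms)

lemma GDERIV_gradient:
  assumes "u differentiable (at z)"
  shows "GDERIV u z :> gradient u z"
proof -
  obtain f' where f': "(u has_derivative f') (at z)"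
    using assms by (auto simp: differentiable_def)
  have "f' = (\<lambda>h. h \<bullet> adjoint f' 1)"
    using adjoint_works[OF has_derivative_linear[OF f'], of _ 1]
    by (metis inner_real_def mult.right_neutral)
  with f' have "GDERIV u z :> adjoint f' 1"
    unfolding gderiv_def by simp
  with gradient_eqI show ?thesis by metis
qed

definition C1_on_disc :: "(complex \<Rightarrow> real) \<Rightarrow> bool" where
  "C1_on_disc u \<longleftrightarrow>
     u differentiable_on ball 0 1 \<and> continuous_on (ball 0 1) (gradient u)"

definition dirichlet_energy :: "(complex \<Rightarrow> real) \<Rightarrow> ennreal" where
  "dirichlet_energy u =
     (\<integral>\<^sup>+ z\<in>ball 0 1. ennreal ((norm (gradient u z))\<^sup>2) \<partial>lborel)"

text \<open>At points outside the open disc, the value of a function is its radial limit,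
  irrespective of what the total function \<open>u\<close> happens to return there.\<close>

definition disc_value :: "(complex \<Rightarrow> real) \<Rightarrow> complex \<Rightarrow> ereal" where
  "disc_value u z =
     (if z \<in> ball 0 1 then ereal (u z)
      else Lim (at_left 1) (\<lambda>r. ereal (u (of_real r * z))))"

definition condenser_admissible ::
  "complex set \<Rightarrow> complex set \<Rightarrow> (complex \<Rightarrow> real) \<Rightarrow> bool" where
  "condenser_admissible E F u \<longleftrightarrow>
     C1_on_disc u \<and>
     (\<forall>\<zeta>\<in>(E \<union> F) - ball 0 1.
        \<exists>l. l \<noteq> - \<infinity> \<and> ((\<lambda>r. ereal (u (of_real r * \<zeta>))) \<longlongrightarrow> l) (at_left 1)) \<and>
     (\<forall>z\<in>E. disc_value u z \<ge> 1) \<and>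
     (\<forall>z\<in>F. disc_value u z \<le> 0)"

text \<open>Only meaningful for disjoint closed subsets of the closed unit disc.\<close>

definition condenser_cap :: "complex set \<Rightarrow> complex set \<Rightarrow> ennreal" where
  "condenser_cap E F = (INF u\<in>{u. condenser_admissible E F u}. dirichlet_energy u)"

definition circle_cap :: "complex set \<Rightarrow> ennreal" where
  "circle_cap E = condenser_cap E (cball 0 (1/2))"

end

theory Submission
  imports Defs
begin

text \<open>
  Let \<open>n\<close> be of order \<open>1 / (1 - r)\<close> and take \<open>n\<close> equally spaced arcs of length about \<open>exp (-n) / n\<close>
  on a fixed arc of the circle. Around each of them a logarithmic cutoff supported in a disc of
  radius of order \<open>1 / n\<close> has energy of order \<open>1 / n\<close>; these discs are disjoint and miss
  the disc of radius \<open>r\<close>, so the union of the arcs has bounded capacity relative to that disc.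
  Relative to the disc of radius \<open>1 / 2\<close> its capacity is bounded below: integrate the gradient of an
  admissible function along curves which start radially in the arcs, fan out up to depth \<open>1 / n\<close> and
  cover a sector afterwards (an extremal length estimate). Finally, cutting the union off at a point
  moving along the circle changes the capacity continuously, so every small value is attained by
  a closed subset, and passing to a subset only decreases the other capacity.
\<close>

subsection \<open>Energy and admissible functions\<close>

text \<open>The two estimates balance because the logarithm of outer over inner radius of a cutoff
  is about \<open>n\<close> and there are \<open>n\<close> arcs: the cutoffs have total energy
  \<open>n * O(1 / n)\<close>, while the extremal length estimate loses only
  \<open>ln (1 / d) / n = O(1)\<close>, where \<open>d\<close> is the slope length of an arc. Hence
  neither bound depends on \<open>r\<close>. The competitors are the main obstacle. They are C1 in
  the open disc only, may be unbounded, need no boundary values off the condenser, and on the circle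
  only their radial limits are prescribed. Maxima and truncations would leave the class, so
  functions are combined as \<open>1 - (1 - u) * (1 - v)\<close> and made bounded by an arctangent.
  Since the first capacity has to equal \<epsilon> exactly, a bound up to constants is not enough:
  the continuity argument needs a subadditivity whose factor on one of the two terms is arbitrarily
  close to 1.\<close>

lemma C1_on_discI:
  assumes "\<And>z. z \<in> ball 0 1 \<Longrightarrow> GDERIV u z :> D z" "continuous_on (ball 0 1) D"
  shows "C1_on_disc u"
proof -
  have "u differentiable (at z)" if "z \<in> ball 0 1" for z
    using assms(1)[OF that] unfolding gderiv_def differentiable_def by blast
  then have "u differentiable_on ball 0 1"
    by (intro differentiable_at_imp_differentiable_on)
  moreover have "continuous_on (ball 0 1) (gradient u)"
    using assms(2) continuous_on_cong[of "ball 0 1" "ball 0 1" "gradient u" D]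
      gradient_eqI[OF assms(1)] by simp
  ultimately show ?thesis
    by (simp add: C1_on_disc_def)
qed

lemma C1_on_disc_GDERIV:
  assumes "C1_on_disc u" "z \<in> ball 0 1"
  shows "GDERIV u z :> gradient u z"
  using assms unfolding C1_on_disc_def
  by (metis GDERIV_gradient at_within_open differentiable_on_def open_ball)

lemma C1_on_disc_continuous_on: "C1_on_disc u \<Longrightarrow> continuous_on (ball 0 1) u"
  by (simp add: C1_on_disc_def differentiable_imp_continuous_on)

lemma C1_on_disc_continuous_on_gradient: "C1_on_disc u \<Longrightarrow> continuous_on (ball 0 1) (gradient u)"
  by (simp add: C1_on_disc_def)

lemma borel_measurable_gradient_sq:
  assumes "C1_on_disc u"
  shows "(\<lambda>z. ennreal ((norm (gradient u z))\<^sup>2) * indicator (ball 0 1) z) \<in> borel_measurable borel"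
proof -
  have "(\<lambda>z. indicator (ball 0 1) z *\<^sub>R (norm (gradient u z))\<^sup>2) \<in> borel_measurable borel"
    by (intro borel_measurable_continuous_on_indicator continuous_intros
        C1_on_disc_continuous_on_gradient assms) auto
  then have "(\<lambda>z. ennreal (indicator (ball 0 1) z *\<^sub>R (norm (gradient u z))\<^sup>2)) \<in> borel_measurable borel"
    by measurable
  also have "(\<lambda>z. ennreal (indicator (ball 0 1) z *\<^sub>R (norm (gradient u z))\<^sup>2)) =
      (\<lambda>z. ennreal ((norm (gradient u z))\<^sup>2) * indicator (ball 0 1) z)"
    by (auto simp: indicator_def)
  finally show ?thesis .
qed

text \<open>The existence clause and the value clause of the definition merge: radial limits are
  unique, so \<open>Lim\<close> returns the limit whenever there is one, and
  \<open>1 \<le> l\<close> already excludes minus infinity.\<close>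

lemma condenser_admissible_iff:
  assumes "E \<subseteq> sphere 0 1" "F \<subseteq> ball 0 1"
  shows "condenser_admissible E F u \<longleftrightarrow> C1_on_disc u \<and>
     (\<forall>\<zeta>\<in>E. \<exists>l\<ge>1. ((\<lambda>r. ereal (u (of_real r * \<zeta>))) \<longlongrightarrow> l) (at_left 1)) \<and> (\<forall>z\<in>F. u z \<le> 0)"
proof -
  have EF: "(E \<union> F) - ball 0 1 = E" "E \<inter> ball 0 1 = {}"
    using assms by auto
  have 1: "(\<exists>l. l \<noteq> -\<infinity> \<and> ((\<lambda>r. ereal (u (of_real r * \<zeta>))) \<longlongrightarrow> l) (at_left 1)) \<and> disc_value u \<zeta> \<ge> 1
     \<longleftrightarrow> (\<exists>l\<ge>1. ((\<lambda>r. ereal (u (of_real r * \<zeta>))) \<longlongrightarrow> l) (at_left 1))" if "\<zeta> \<in> E" for \<zeta>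
  proof -
    have "disc_value u \<zeta> = Lim (at_left 1) (\<lambda>r. ereal (u (of_real r * \<zeta>)))"
      using that EF by (auto simp: disc_value_def)
    moreover have "Lim (at_left 1) (\<lambda>r. ereal (u (of_real r * \<zeta>))) = l"
      if "((\<lambda>r. ereal (u (of_real r * \<zeta>))) \<longlongrightarrow> l) (at_left (1::real))" for l
      using that by (intro tendsto_Lim) auto
    moreover have "l \<noteq> -\<infinity>" if "1 \<le> l" for l :: ereal
      using that by auto
    ultimately show ?thesis
      by metis
  qed
  have 2: "disc_value u z \<le> 0 \<longleftrightarrow> u z \<le> 0" if "z \<in> F" for z
  proof -
    have "z \<in> ball 0 1"
      using that assms by auto
    then show ?thesis
      unfolding disc_value_def by (simp add: zero_ereal_def)
  qed
  show ?thesis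
    unfolding condenser_admissible_def EF using 1 2 by blast
qed

lemma condenser_cap_le:
  "condenser_admissible E F u \<Longrightarrow> condenser_cap E F \<le> dirichlet_energy u"
  unfolding condenser_cap_def by (intro INF_lower) simp

lemma condenser_cap_mono:
  assumes "E \<subseteq> E'" "F \<subseteq> F'" "E' \<subseteq> sphere 0 1" "F' \<subseteq> ball 0 1"
  shows "condenser_cap E F \<le> condenser_cap E' F'"
proof -
  have "condenser_admissible E F u" if "condenser_admissible E' F' u" for u
    using that assms condenser_admissible_iff[of E' F' u] condenser_admissible_iff[of E F u]
    by (meson order_trans subsetD)
  then show ?thesis
    unfolding condenser_cap_def by (intro INF_superset_mono) auto
qed

lemma GDERIV_sum:
  assumes "\<And>i. i \<in> I \<Longrightarrow> GDERIV (f i) x :> D i"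
  shows "GDERIV (\<lambda>x. \<Sum>i\<in>I. f i x) x :> (\<Sum>i\<in>I. D i)"
  using assms unfolding gderiv_def inner_sum_right by (intro has_derivative_sum) auto

text \<open>Pointwise form of the additivity of energy for functions whose gradients have disjoint
  supports.\<close>

lemma power2_norm_sum_of_at_most_one_nonzero:
  fixes a :: "'i \<Rightarrow> 'a::real_normed_vector"
  assumes "\<And>i j. i \<in> I \<Longrightarrow> j \<in> I \<Longrightarrow> i \<noteq> j \<Longrightarrow> a i = 0 \<or> a j = 0"
  shows "(norm (\<Sum>i\<in>I. a i))\<^sup>2 \<le> (\<Sum>i\<in>I. (norm (a i))\<^sup>2)"
proof (cases "finite I \<and> (\<exists>i\<in>I. a i \<noteq> 0)")
  case True
  then obtain i where i: "i \<in> I" "a i \<noteq> 0" and fin: "finite I" by auto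
  have "(\<Sum>j\<in>I. a j) = a i"
    using assms i fin by (subst sum.remove[of _ i]) (auto intro!: sum.neutral)
  moreover have "(norm (a i))\<^sup>2 \<le> (\<Sum>i\<in>I. (norm (a i))\<^sup>2)"
    using fin i by (intro member_le_sum) auto
  ultimately show ?thesis by simp
next
  case False
  then have "(\<Sum>i\<in>I. a i) = 0"
    by (meson sum.infinite sum.neutral)
  then show ?thesis
    by (simp add: sum_nonneg)
qed

subsection \<open>Slope coordinates\<close>

text \<open>Near the positive real axis polar coordinates are replaced by radius and slope, so that
  affine substitutions and Tonelli suffice.\<close>

definition slope_pt :: "real \<Rightarrow> complex" where
  "slope_pt m = cis (arctan m)"

lemma norm_slope_pt [simp]: "norm (slope_pt m) = 1"
  by (simp add: slope_pt_def)

lemma slope_pt_has_vector_derivative: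
  "(slope_pt has_vector_derivative \<i> * slope_pt m * of_real (inverse (1 + m\<^sup>2))) (at m)"
proof -
  have "(arctan has_derivative (\<lambda>h. h * inverse (1 + m\<^sup>2))) (at m)"
    using DERIV_arctan[of m] unfolding has_field_derivative_def by (subst mult.commute)
  then have "((\<lambda>x. cis (arctan x)) has_derivative
      (\<lambda>h. (h * inverse (1 + m\<^sup>2)) *\<^sub>R (\<i> * cis (arctan m)))) (at m)"
    by (rule has_derivative_cis)
  then show ?thesis
    by (simp add: slope_pt_def[abs_def] has_vector_derivative_def scaleR_conv_of_real mult_ac)
qed

lemma continuous_on_slope_pt [continuous_intros]:
  "continuous_on A f \<Longrightarrow> continuous_on A (\<lambda>x. slope_pt (f x))"
  unfolding slope_pt_def cis_conv_exp by (intro continuous_intros)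

lemma borel_measurable_slope_pt [measurable]: "slope_pt \<in> borel_measurable borel"
  by (intro borel_measurable_continuous_onI continuous_intros)

lemma slope_pt_conv: "slope_pt m = of_real (cos (arctan m)) * Complex 1 m"
proof -
  have "sin (arctan m) = cos (arctan m) * m"
    using tan_arctan[of m] cos_arctan_not_zero[of m] by (simp add: tan_def field_simps)
  then show ?thesis
    by (simp add: slope_pt_def complex_eq_iff)
qed

lemma cos_arctan_bounds:
  assumes "0 \<le> m" "m \<le> 1"
  shows "0 < cos (arctan m)" "1 / 2 \<le> (cos (arctan m))\<^sup>2" "cos (arctan m) \<le> 1"
proof -
  have "m\<^sup>2 \<le> 1" using assms by (simp add: power_le_one)
  have "0 < 1 + m\<^sup>2" by (simp add: add_pos_nonneg)
  show "0 < cos (arctan m)" "cos (arctan m) \<le> 1"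
    using \<open>0 < 1 + m\<^sup>2\<close> by (auto simp: cos_arctan)
  show "1 / 2 \<le> (cos (arctan m))\<^sup>2"
    using \<open>m\<^sup>2 \<le> 1\<close> \<open>0 < 1 + m\<^sup>2\<close> by (simp add: cos_arctan power_divide field_simps)
qed

lemma dist_slope_pt_le: "dist (slope_pt a) (slope_pt b) \<le> \<bar>a - b\<bar>"
proof -
  have "norm (slope_pt a - slope_pt b) \<le> 1 * norm (a - b)"
  proof (rule differentiable_bound[of UNIV])
    fix x :: real
    show "(slope_pt has_derivative (\<lambda>h. h *\<^sub>R (\<i> * slope_pt x * of_real (inverse (1 + x\<^sup>2))))) (at x within UNIV)"
      using slope_pt_has_vector_derivative[of x] unfolding has_vector_derivative_def by blast
    have "norm (\<i> * slope_pt x * of_real (inverse (1 + x\<^sup>2))) \<le> 1"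
      unfolding norm_mult norm_of_real by (simp add: inverse_le_1_iff)
    then show "onorm (\<lambda>h. h *\<^sub>R (\<i> * slope_pt x * of_real (inverse (1 + x\<^sup>2)))) \<le> 1"
      by (intro onorm_bound) (auto simp: mult_left_le simp del: of_real_inverse)
  qed auto
  then show ?thesis
    by (simp add: dist_norm)
qed

text \<open>The chord is at least the sine of the angle between the points. That sine is
  \<open>c * d * (a - b)\<close> up to sign, and both cosines are at least \<open>1 / sqrt 2\<close>
  for slopes in \<open>{0..1}\<close>.\<close>

lemma dist_slope_pt_ge:
  assumes "0 \<le> a" "a \<le> 1" "0 \<le> b" "b \<le> 1"
  shows "\<bar>a - b\<bar> / 2 \<le> dist (slope_pt a) (slope_pt b)"
proof -
  define c d where "c = cos (arctan a)" and "d = cos (arctan b)"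
  have c: "0 < c" "1 / 2 \<le> c\<^sup>2" and d: "0 < d" "1 / 2 \<le> d\<^sup>2"
    using cos_arctan_bounds assms by (auto simp: c_def d_def)
  have "1 / 2 * (1 / 2) \<le> c\<^sup>2 * d\<^sup>2"
    using c d by (intro mult_mono) auto
  then have "(1 / 2)\<^sup>2 \<le> (c * d)\<^sup>2"
    by (simp add: power_mult_distrib power_divide)
  then have cd: "1 / 2 \<le> c * d"
    using c d by (intro power2_le_imp_le[of "1/2" "c*d"]) auto
  have "Im ((slope_pt a - slope_pt b) * cnj (slope_pt b)) = c * d * (a - b)"
    unfolding slope_pt_conv c_def[symmetric] d_def[symmetric] by (simp add: algebra_simps)
  then have "c * d * \<bar>a - b\<bar> = \<bar>Im ((slope_pt a - slope_pt b) * cnj (slope_pt b))\<bar>"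
    using c d by (simp add: abs_mult)
  also have "\<dots> \<le> norm ((slope_pt a - slope_pt b) * cnj (slope_pt b))"
    by (rule abs_Im_le_cmod)
  also have "\<dots> = dist (slope_pt a) (slope_pt b)"
    by (simp add: norm_mult dist_norm)
  finally show ?thesis
    using mult_right_mono[OF cd, of "\<bar>a - b\<bar>"] by simp
qed

section \<open>Area integrals in slope coordinates\<close>

lemma nn_integral_lborel_complex:
  assumes [measurable]: "f \<in> borel_measurable borel"
  shows "(\<integral>\<^sup>+z. f z \<partial>lborel) = (\<integral>\<^sup>+x. \<integral>\<^sup>+y. f (Complex x y) \<partial>lborel \<partial>lborel)"
proof -
  define T where "T = (\<lambda>p::real \<times> real. Complex (fst p) (snd p))"
  have "continuous_on UNIV T"
    unfolding T_def Complex_eq by (intro continuous_intros)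
  then have [measurable]: "T \<in> borel \<rightarrow>\<^sub>M borel"
    by (rule borel_measurable_continuous_onI)
  have "(lborel :: complex measure) = distr lborel borel T"
  proof (rule lborel_eqI)
    fix l u :: complex
    assume lu: "\<And>b. b \<in> Basis \<Longrightarrow> l \<bullet> b \<le> u \<bullet> b"
    have "Re l \<le> Re u" "Im l \<le> Im u"
      using lu[of 1] lu[of \<i>] by (auto simp: Basis_complex_def)
    moreover have "T -` box l u = box (Re l, Im l) (Re u, Im u)"
      by (auto simp: T_def in_box_complex_iff mem_box Basis_prod_def)
    ultimately show "emeasure (distr lborel borel T) (box l u) = (\<Prod>b\<in>Basis. (u - l) \<bullet> b)"
      by (subst emeasure_distr) (auto simp: emeasure_lborel_box_eq Basis_complex_def Basis_prod_def
          inner_complex_def prod.union_disjoint)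
  qed simp
  then have "(\<integral>\<^sup>+z. f z \<partial>lborel) = (\<integral>\<^sup>+z. f z \<partial>distr lborel borel T)"
    by simp
  also have "\<dots> = (\<integral>\<^sup>+p. f (T p) \<partial>(lborel \<Otimes>\<^sub>M lborel))"
    by (subst nn_integral_distr) (simp_all add: lborel_prod)
  also have "\<dots> = (\<integral>\<^sup>+x. \<integral>\<^sup>+y. f (T (x, y)) \<partial>lborel \<partial>lborel)"
    by (subst lborel.nn_integral_fst[symmetric]) (simp_all add: lborel_prod)
  finally show ?thesis
    by (simp add: T_def)
qed

text \<open>Slopes are traded for ordinates at fixed abscissa (\<open>y = x * m\<close>, Jacobian
  \<open>x\<close>), and depths for abscissae at fixed slope (\<open>x = c * (1 - t)\<close>,
  Jacobian \<open>c\<close>). The total Jacobian \<open>c * (c * (1 - t))\<close> is at least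
  \<open>1 / 2 * (1 / 2)\<close> on the sector, whence the factor 4.\<close>

lemma nn_integral_slope_polar:
  assumes [measurable]: "f \<in> borel_measurable borel"
  shows "(\<integral>\<^sup>+t\<in>{0..1/2}. \<integral>\<^sup>+m\<in>{0..1}. f (of_real (1 - t) * slope_pt m) \<partial>lborel \<partial>lborel)
    \<le> 4 * (\<integral>\<^sup>+z. f z \<partial>lborel)"
proof -
  have cmeas: "Complex 1 \<in> borel_measurable borel"
    unfolding Complex_eq by measurable
  note [measurable] = cmeas
  define h where "h = (\<lambda>m x::real. ennreal x * f (of_real x * Complex 1 m) * indicator {0..1} m * indicator {0<..} x)"
  have [measurable]: "case_prod h \<in> borel_measurable (borel \<Otimes>\<^sub>M borel)"
    unfolding h_def by measurable
  have *: "(\<integral>\<^sup>+m. h m x \<partial>lborel) \<le> (\<integral>\<^sup>+y. f (Complex x y) \<partial>lborel)" for x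
  proof (cases "x > 0")
    case True
    have [measurable]: "Complex x \<in> borel_measurable borel"
      unfolding Complex_eq by measurable
    have "of_real x * Complex 1 m = Complex x (x * m)" for m
      by (simp add: complex_eq_iff)
    then have "(\<integral>\<^sup>+m. h m x \<partial>lborel) \<le> (\<integral>\<^sup>+m. ennreal x * f (Complex x (x * m)) \<partial>lborel)"
      unfolding h_def by (intro nn_integral_mono) (auto simp: indicator_def)
    also have "\<dots> = (\<integral>\<^sup>+y. f (Complex x y) \<partial>lborel)"
      using True nn_integral_real_affine[of "\<lambda>y. f (Complex x y)" x 0]
      by (simp add: nn_integral_cmult)
    finally show ?thesis .
  qed (simp add: h_def)
  have **: "(\<integral>\<^sup>+t\<in>{0..1/2}. f (of_real (1 - t) * slope_pt m) \<partial>lborel) * indicator {0..1} m \<le> 4 * (\<integral>\<^sup>+x. h m x \<partial>lborel)" for m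
  proof (cases "m \<in> {0..1}")
    case True
    define c where "c = cos (arctan m)"
    have c: "0 < c" "1 / 2 \<le> c\<^sup>2"
      using cos_arctan_bounds[of m] True by (auto simp: c_def)
    have "(\<integral>\<^sup>+t\<in>{0..1/2}. f (of_real (1 - t) * slope_pt m) \<partial>lborel) \<le> (\<integral>\<^sup>+t. 4 * (ennreal c * h m (c + (- c) * t)) \<partial>lborel)"
    proof (intro nn_integral_mono)
      fix t :: real
      show "f (of_real (1 - t) * slope_pt m) * indicator {0..1/2} t \<le> 4 * (ennreal c * h m (c + (- c) * t))"
      proof (cases "t \<in> {0..1/2}")
        case t: True
        have "1 \<le> 4 * (c * (c * (1 - t)))"
        proof -
          have "1 / 2 * (1 / 2) \<le> c\<^sup>2 * (1 - t)"
            using c t by (intro mult_mono) auto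
          then show ?thesis by (simp add: power2_eq_square mult_ac)
        qed
        moreover have "0 < c * (1 - t)"
          using c t by simp
        moreover have "of_real (c + (- c) * t) * Complex 1 m = of_real (1 - t) * slope_pt m"
          by (simp add: slope_pt_conv c_def[symmetric] complex_eq_iff algebra_simps)
        moreover have ct: "c + (- c) * t = c * (1 - t)"
          by (simp add: algebra_simps)
        ultimately have "h m (c + (- c) * t) = ennreal (c * (1 - t)) * f (of_real (1 - t) * slope_pt m)"
          using True unfolding h_def by (simp only: ct) simp
        moreover have "ennreal (4 * (c * (c * (1 - t)))) = 4 * (ennreal c * ennreal (c * (1 - t)))"
          using c by (simp only: ennreal_mult') simp
        ultimately have "4 * (ennreal c * h m (c + (- c) * t)) = ennreal (4 * (c * (c * (1 - t)))) * f (of_real (1 - t) * slope_pt m)"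
          by (simp only: mult.assoc)
        moreover have "1 * f (of_real (1 - t) * slope_pt m) \<le> ennreal (4 * (c * (c * (1 - t)))) * f (of_real (1 - t) * slope_pt m)"
          using \<open>1 \<le> 4 * (c * (c * (1 - t)))\<close> by (intro mult_right_mono) (simp_all add: ennreal_ge_1)
        ultimately show ?thesis
          using t by simp
      qed simp
    qed
    also have "\<dots> = 4 * (ennreal \<bar>- c\<bar> * (\<integral>\<^sup>+t. h m (c + (- c) * t) \<partial>lborel))"
      using c by (simp add: nn_integral_cmult)
    also have "\<dots> = 4 * (\<integral>\<^sup>+x. h m x \<partial>lborel)"
      using c nn_integral_real_affine[of "h m" "-c" c] by simp
    finally show ?thesis
      using True by simp
  qed simp
  have "(\<integral>\<^sup>+t\<in>{0..1/2}. \<integral>\<^sup>+m\<in>{0..1}. f (of_real (1 - t) * slope_pt m) \<partial>lborel \<partial>lborel)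
      = (\<integral>\<^sup>+t. \<integral>\<^sup>+m. f (of_real (1 - t) * slope_pt m) * indicator {0..1} m * indicator {0..1/2} t \<partial>lborel \<partial>lborel)"
    by (intro nn_integral_cong nn_integral_multc[symmetric]) simp
  also have "\<dots> = (\<integral>\<^sup>+m. \<integral>\<^sup>+t. f (of_real (1 - t) * slope_pt m) * indicator {0..1} m * indicator {0..1/2} t \<partial>lborel \<partial>lborel)"
    by (rule lborel_pair.Fubini') measurable
  also have "\<dots> = (\<integral>\<^sup>+m. (\<integral>\<^sup>+t\<in>{0..1/2}. f (of_real (1 - t) * slope_pt m) \<partial>lborel) * indicator {0..1} m \<partial>lborel)"
    by (intro nn_integral_cong, subst nn_integral_multc[symmetric]) (simp_all add: mult_ac)
  also have "\<dots> \<le> (\<integral>\<^sup>+m. 4 * (\<integral>\<^sup>+x. h m x \<partial>lborel) \<partial>lborel)"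
    by (intro nn_integral_mono **)
  also have "\<dots> = 4 * (\<integral>\<^sup>+m. \<integral>\<^sup>+x. h m x \<partial>lborel \<partial>lborel)"
    by (rule nn_integral_cmult) measurable
  also have "(\<integral>\<^sup>+m. \<integral>\<^sup>+x. h m x \<partial>lborel \<partial>lborel) = (\<integral>\<^sup>+x. \<integral>\<^sup>+m. h m x \<partial>lborel \<partial>lborel)"
    by (rule lborel_pair.Fubini') measurable
  also have "\<dots> \<le> (\<integral>\<^sup>+x. \<integral>\<^sup>+y. f (Complex x y) \<partial>lborel \<partial>lborel)"
    by (intro nn_integral_mono *)
  also have "\<dots> = (\<integral>\<^sup>+z. f z \<partial>lborel)"
    by (rule nn_integral_lborel_complex[symmetric]) measurable
  finally show ?thesis
    by (simp add: mult_left_mono)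
qed

subsection \<open>Logarithmic cutoffs\<close>

text \<open>A C1 transition from 0 to 1 on the unit interval: \<open>(max 0 y)\<^sup>2\<close> is C1
  in \<open>y\<close>, and the formula nests two such squares.\<close>

definition smooth_step :: "real \<Rightarrow> real" where
  "smooth_step s = 1 - (max 0 (1 - (max 0 s)\<^sup>2))\<^sup>2"

definition smooth_step' :: "real \<Rightarrow> real" where
  "smooth_step' s = 4 * max 0 (1 - (max 0 s)\<^sup>2) * max 0 s"

lemma DERIV_max0_sq: "((\<lambda>s::real. (max 0 s)\<^sup>2) has_real_derivative 2 * max 0 s) (at s)"
proof -
  consider "s > 0" | "s < 0" | "s = 0" by linarith
  then show ?thesis
  proof cases
    case 1
    have "((\<lambda>s::real. s\<^sup>2) has_real_derivative 2 * max 0 s) (at s)"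
      using 1 by (auto intro!: derivative_eq_intros)
    then show ?thesis
      by (rule has_field_derivative_transform_within_open[of _ _ _ "{0<..}"]) (use 1 in auto)
  next
    case 2
    have "((\<lambda>s::real. 0) has_real_derivative 2 * max 0 s) (at s)"
      using 2 by (auto intro!: derivative_eq_intros)
    then show ?thesis
      by (rule has_field_derivative_transform_within_open[of _ _ _ "{..<0}"]) (use 2 in auto)
  next
    case 3
    have "((\<lambda>h::real. max 0 h) \<longlongrightarrow> 0) (at 0)"
      using tendsto_max[OF tendsto_const tendsto_ident_at, of "0::real" 0 UNIV] by simp
    then have "((\<lambda>h::real. ((max 0 (0 + h))\<^sup>2 - (max 0 0)\<^sup>2) / h) \<longlongrightarrow> 0) (at 0)"
      by (rule Lim_transform_eventually)
        (auto simp: eventually_at_filter max_def power2_eq_square)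
    then show ?thesis
      unfolding 3 DERIV_def by simp
  qed
qed

lemma DERIV_smooth_step: "(smooth_step has_real_derivative smooth_step' s) (at s)"
proof -
  have "((\<lambda>s. 1 - (max 0 s)\<^sup>2) has_real_derivative - (2 * max 0 s)) (at s)"
    using DERIV_diff[OF DERIV_const DERIV_max0_sq, of 1 s] by simp
  from DERIV_diff[OF DERIV_const DERIV_chain2[OF DERIV_max0_sq this], of 1]
  show ?thesis
    by (simp add: smooth_step_def[abs_def] smooth_step'_def mult.assoc)
qed

lemma smooth_step_bounds: "0 \<le> smooth_step s" "smooth_step s \<le> 1"
  unfolding smooth_step_def by (auto intro: power_le_one)

lemma smooth_step_eq_0: "s \<le> 0 \<Longrightarrow> smooth_step s = 0"
  by (simp add: smooth_step_def)

lemma smooth_step_eq_1: "1 \<le> s \<Longrightarrow> smooth_step s = 1"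
  by (simp add: smooth_step_def)

lemma smooth_step'_eq_0: "s \<le> 0 \<Longrightarrow> smooth_step' s = 0"
  by (simp add: smooth_step'_def)

lemma smooth_step'_bound: "\<bar>smooth_step' s\<bar> \<le> 4"
proof (cases "0 < s \<and> s < 1")
  case True
  then have "(1 - s\<^sup>2) * s \<le> 1 * 1"
    by (intro mult_mono) (auto simp: power_le_one)
  moreover have "0 \<le> (1 - s\<^sup>2) * s"
    using True by (simp add: power_le_one)
  moreover have "smooth_step' s = 4 * ((1 - s\<^sup>2) * s)"
    using True by (simp add: smooth_step'_def power_le_one)
  ultimately show ?thesis
    by simp
next
  case False
  then have "smooth_step' s = 0"
    by (cases "s \<le> 0") (auto simp: smooth_step'_def one_le_power)
  then show ?thesis by simp
qed

lemma continuous_on_smooth_step' [continuous_intros]: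
  "continuous_on A f \<Longrightarrow> continuous_on A (\<lambda>x. smooth_step' (f x))"
  unfolding smooth_step'_def by (intro continuous_intros)

lemma continuous_on_smooth_step [continuous_intros]:
  "continuous_on A f \<Longrightarrow> continuous_on A (\<lambda>x. smooth_step (f x))"
  unfolding smooth_step_def by (intro continuous_intros)

text \<open>A logarithmic cutoff between the radii \<open>R exp (-N)\<close> and \<open>R\<close>; the summand
  \<open>(R exp (-N))\<^sup>2\<close> removes the singularity at the centre.\<close>

definition log_dist :: "complex \<Rightarrow> real \<Rightarrow> nat \<Rightarrow> complex \<Rightarrow> real" where
  "log_dist p R N z = (ln (R\<^sup>2) - ln ((norm (z - p))\<^sup>2 + (R * exp (- real N))\<^sup>2)) / real N"

definition bump :: "complex \<Rightarrow> real \<Rightarrow> nat \<Rightarrow> complex \<Rightarrow> real" where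
  "bump p R N z = smooth_step (log_dist p R N z)"

definition bump_grad :: "complex \<Rightarrow> real \<Rightarrow> nat \<Rightarrow> complex \<Rightarrow> complex" where
  "bump_grad p R N z =
     (- 2 * smooth_step' (log_dist p R N z) / (real N * ((norm (z - p))\<^sup>2 + (R * exp (- real N))\<^sup>2))) *\<^sub>R (z - p)"

context
  fixes R :: real and N :: nat and p :: complex
  assumes R: "R > 0" and N: "N \<ge> 1"
begin

private lemma denom_pos: "0 < (norm (z - p))\<^sup>2 + (R * exp (- real N))\<^sup>2"
  using R by (intro add_nonneg_pos) auto

lemma bump_GDERIV: "GDERIV (bump p R N) z :> bump_grad p R N z"
proof -
  let ?d = "(R * exp (- real N))\<^sup>2"
  have 1: "GDERIV (\<lambda>z. (norm (z - p))\<^sup>2) z :> 2 *\<^sub>R (z - p)"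
    unfolding gderiv_def power2_norm_eq_inner
    by (auto intro!: derivative_eq_intros simp: inner_commute)
  have "((\<lambda>y. (ln (R\<^sup>2) - ln (y + ?d)) / real N) has_real_derivative
      - 1 / (real N * ((norm (z - p))\<^sup>2 + ?d))) (at ((norm (z - p))\<^sup>2))"
    using denom_pos[of z] N by (auto intro!: derivative_eq_intros)
  from GDERIV_DERIV_compose[OF 1 DERIV_chain2[OF DERIV_smooth_step this]]
  show ?thesis
    unfolding bump_def[abs_def] log_dist_def bump_grad_def by (simp add: scaleR_scaleR mult_ac)
qed

lemma continuous_on_log_dist: "continuous_on A (log_dist p R N)"
  unfolding log_dist_def using denom_pos N R by (intro continuous_intros) (auto simp: less_imp_neq[symmetric])

lemma continuous_on_bump: "continuous_on A (bump p R N)"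
  unfolding bump_def by (intro continuous_intros continuous_on_log_dist)

lemma continuous_on_bump_grad: "continuous_on A (bump_grad p R N)"
  unfolding bump_grad_def using denom_pos N
  by (intro continuous_intros continuous_on_log_dist) (metis mult_eq_0_iff not_one_le_zero of_nat_eq_0_iff less_irrefl)

lemma bump_C1_on_disc: "C1_on_disc (bump p R N)"
  by (rule C1_on_discI[OF bump_GDERIV continuous_on_bump_grad])

lemma bump_gradient: "gradient (bump p R N) z = bump_grad p R N z"
  by (rule gradient_eqI[OF bump_GDERIV])

lemma bump_bounds: "0 \<le> bump p R N z" "bump p R N z \<le> 1"
  by (simp_all add: bump_def smooth_step_bounds)

lemma log_dist_nonpos:
  assumes "dist z p \<ge> R"
  shows "log_dist p R N z \<le> 0"
proof -
  have "R\<^sup>2 \<le> (norm (z - p))\<^sup>2"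
    using assms R by (simp add: dist_norm)
  then have "R\<^sup>2 \<le> (norm (z - p))\<^sup>2 + (R * exp (- real N))\<^sup>2"
    by (rule order_trans) simp
  then have "ln (R\<^sup>2) \<le> ln ((norm (z - p))\<^sup>2 + (R * exp (- real N))\<^sup>2)"
    using R by (intro ln_mono) auto
  then show ?thesis
    by (simp add: log_dist_def divide_nonpos_nonneg)
qed

lemma bump_eq_0: "dist z p \<ge> R \<Longrightarrow> bump p R N z = 0"
  by (simp add: bump_def smooth_step_eq_0 log_dist_nonpos)

lemma bump_grad_eq_0: "dist z p \<ge> R \<Longrightarrow> bump_grad p R N z = 0"
  by (simp add: bump_grad_def smooth_step'_eq_0 log_dist_nonpos)

text \<open>Both logarithms are taken of squares, so \<open>log_dist\<close> would reach almost 2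
  near the centre. This slack pays for the extra summand: the denominator is at most
  \<open>2 * R\<^sup>2 * exp (- 2 * N)\<close>, and
  \<open>2 \<le> exp 1 \<le> exp N\<close>.\<close>

lemma bump_eq_1:
  assumes "dist z p \<le> R * exp (- real N)"
  shows "bump p R N z = 1"
proof -
  have "(norm (z - p))\<^sup>2 \<le> (R * exp (- real N))\<^sup>2"
    using assms by (simp add: dist_norm power_mono)
  then have "(norm (z - p))\<^sup>2 + (R * exp (- real N))\<^sup>2 \<le> 2 * (R * exp (- real N))\<^sup>2"
    by simp
  also have "\<dots> \<le> exp 1 * (R * exp (- real N))\<^sup>2"
    using exp_ge_add_one_self[of 1] by (intro mult_right_mono) auto
  also have "\<dots> \<le> R\<^sup>2 * exp (- real N)"
  proof -
    have "exp (1 :: real) * (exp (- real N))\<^sup>2 = exp (1 - 2 * real N)"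
      by (simp add: power2_eq_square flip: exp_add)
    also have "\<dots> \<le> exp (- real N)"
      using N by simp
    finally show ?thesis
      using R by (simp add: power_mult_distrib mult_left_mono mult.left_commute)
  qed
  finally have "ln ((norm (z - p))\<^sup>2 + (R * exp (- real N))\<^sup>2) \<le> ln (R\<^sup>2 * exp (- real N))"
    using denom_pos by (intro ln_mono) (use R in auto)
  also have "\<dots> = ln (R\<^sup>2) - real N"
    using R by (simp add: ln_mult)
  finally have "1 \<le> log_dist p R N z"
    using N by (simp add: log_dist_def field_simps)
  then show ?thesis
    by (simp add: bump_def smooth_step_eq_1)
qed

text \<open>The 64 is \<open>2\<^sup>2 * 4\<^sup>2\<close>, from the derivative of the squared
  distance and the bound on \<open>smooth_step'\<close>. One of the two denominators absorbs
  \<open>(norm (z - p))\<^sup>2\<close>.\<close>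

lemma norm_bump_grad_sq_le:
  "(norm (bump_grad p R N z))\<^sup>2 \<le>
     64 / (real N)\<^sup>2 * (1 / ((norm (z - p))\<^sup>2 + (R * exp (- real N))\<^sup>2)) * indicator (ball p R) z"
proof (cases "z \<in> ball p R")
  case True
  define A where "A = (norm (z - p))\<^sup>2 + (R * exp (- real N))\<^sup>2"
  have A: "0 < A" "(norm (z - p))\<^sup>2 \<le> A"
    using denom_pos by (auto simp: A_def)
  have "(smooth_step' (log_dist p R N z))\<^sup>2 \<le> 4\<^sup>2"
    using smooth_step'_bound by (intro power2_le_iff_abs_le[THEN iffD2]) auto
  then have "(smooth_step' (log_dist p R N z))\<^sup>2 * (norm (z - p))\<^sup>2 \<le> 4\<^sup>2 * A"
    using A by (intro mult_mono) auto
  then have "4 * ((smooth_step' (log_dist p R N z))\<^sup>2 * (norm (z - p))\<^sup>2) / ((real N)\<^sup>2 * A\<^sup>2) \<le> 4 * (4\<^sup>2 * A) / ((real N)\<^sup>2 * A\<^sup>2)"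
    by (intro divide_right_mono mult_left_mono) auto
  also have "\<dots> = 64 / (real N)\<^sup>2 * (1 / A)"
    using A by (simp add: power2_eq_square)
  also have "4 * ((smooth_step' (log_dist p R N z))\<^sup>2 * (norm (z - p))\<^sup>2) / ((real N)\<^sup>2 * A\<^sup>2) = (norm (bump_grad p R N z))\<^sup>2"
    unfolding bump_grad_def A_def[symmetric] by (simp add: power_mult_distrib power_divide)
  finally show ?thesis
    using True by (simp add: A_def)
qed (simp add: bump_grad_eq_0 dist_commute)

text \<open>On the annulus between the radii \<open>R * exp (- (j + 1))\<close> and
  \<open>R * exp (- j)\<close> the left side is at most the \<open>j\<close>-th coefficient. With
  this step function as majorant the energy integral only needs areas of discs.\<close>

lemma dyadic_bound:
  assumes "0 \<le> s" "s < R"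
  shows "1 / (s\<^sup>2 + (R * exp (- real N))\<^sup>2) \<le>
    (\<Sum>j\<le>N. exp (2 * (real j + 1)) / R\<^sup>2 * indicator {..<R * exp (- real j)} s)"
proof -
  \<comment> \<open>Outside the innermost disc, \<open>j\<close> is one less than the first
    \<open>k\<close> with \<open>R * exp (- k) \<le> s\<close>; that \<open>k\<close> is not 0
    because \<open>s < R\<close>.\<close>
  have "\<exists>j\<le>N. s < R * exp (- real j) \<and> R * exp (- (real j + 1)) \<le> max s (R * exp (- real N))"
  proof (cases "s < R * exp (- real N)")
    case True
    then show ?thesis
      using R by (intro exI[of _ N]) auto
  next
    case False
    then obtain k where k: "k \<le> N" "\<forall>i<k. \<not> R * exp (- real i) \<le> s" "R * exp (- real k) \<le> s"
      using ex_least_nat_le[of "\<lambda>k. R * exp (- real k) \<le> s" N] by (auto simp: not_less)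
    with assms have "k \<noteq> 0" by (intro notI) simp
    then obtain j where "k = Suc j" using not0_implies_Suc by blast
    with k show ?thesis
      by (intro exI[of _ j]) (auto simp: not_le add_ac)
  qed
  then obtain j where j: "j \<le> N" "s < R * exp (- real j)"
    "R * exp (- (real j + 1)) \<le> max s (R * exp (- real N))" by blast
  have "(R * exp (- (real j + 1)))\<^sup>2 \<le> (max s (R * exp (- real N)))\<^sup>2"
    using j R by (intro power_mono) auto
  also have "\<dots> \<le> s\<^sup>2 + (R * exp (- real N))\<^sup>2"
    by (auto simp: max_def)
  finally have "1 / (s\<^sup>2 + (R * exp (- real N))\<^sup>2) \<le> 1 / (R * exp (- (real j + 1)))\<^sup>2"
    using R by (intro divide_left_mono mult_pos_pos zero_less_power add_nonneg_pos) auto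
  also have "\<dots> = exp (2 * (real j + 1)) / R\<^sup>2 * indicator {..<R * exp (- real j)} s"
    using j R by (simp add: power_mult_distrib exp_minus field_simps flip: exp_double exp_add)
  also have "\<dots> \<le> (\<Sum>j\<le>N. exp (2 * (real j + 1)) / R\<^sup>2 * indicator {..<R * exp (- real j)} s)"
    using j by (intro member_le_sum[where f = "\<lambda>j. exp (2 * (real j + 1)) / R\<^sup>2 * indicator {..<R * exp (- real j)} s"]) auto
  finally show ?thesis .
qed

text \<open>In the dyadic majorant the growth of the coefficient cancels the area of the disc, so
  each of the \<open>N + 1\<close> scales contributes the same
  \<open>64 * pi * exp 2 / N\<^sup>2\<close>. Then \<open>N + 1 \<le> 2 * N\<close> gives the
  constant.\<close>

lemma dirichlet_energy_bump_le: "dirichlet_energy (bump p R N) \<le> ennreal (128 * pi * exp 2 / real N)"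
proof -
  define c where "c = (\<lambda>j. 64 / (real N)\<^sup>2 * (exp (2 * (real j + 1)) / R\<^sup>2))"
  have "dirichlet_energy (bump p R N) \<le>
      (\<integral>\<^sup>+z. (\<Sum>j\<le>N. ennreal (c j) * indicator (ball p (R * exp (- real j))) z) \<partial>lborel)"
    unfolding dirichlet_energy_def bump_gradient
  proof (intro nn_integral_mono)
    fix z :: complex
    have "(norm (bump_grad p R N z))\<^sup>2 \<le> (\<Sum>j\<le>N. c j * indicator (ball p (R * exp (- real j))) z)"
    proof (cases "z \<in> ball p R")
      case True
      have "(norm (bump_grad p R N z))\<^sup>2 \<le>
          64 / (real N)\<^sup>2 * (1 / ((norm (z - p))\<^sup>2 + (R * exp (- real N))\<^sup>2))"
        using norm_bump_grad_sq_le[of z] True by simp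
      also have "\<dots> \<le> 64 / (real N)\<^sup>2 *
          (\<Sum>j\<le>N. exp (2 * (real j + 1)) / R\<^sup>2 * indicator {..<R * exp (- real j)} (norm (z - p)))"
        using True by (intro mult_left_mono dyadic_bound) (auto simp: dist_norm norm_minus_commute)
      also have "\<dots> = (\<Sum>j\<le>N. c j * indicator (ball p (R * exp (- real j))) z)"
        unfolding sum_distrib_left c_def
        by (intro sum.cong refl) (auto simp: indicator_def dist_norm norm_minus_commute)
      finally show ?thesis .
    next
      case False
      then show ?thesis
        by (simp add: bump_grad_eq_0 dist_commute c_def sum_nonneg)
    qed
    then have "ennreal ((norm (bump_grad p R N z))\<^sup>2) \<le> ennreal (\<Sum>j\<le>N. c j * indicator (ball p (R * exp (- real j))) z)"
      by (rule ennreal_leI)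
    also have "\<dots> = (\<Sum>j\<le>N. ennreal (c j * indicator (ball p (R * exp (- real j))) z))"
      by (rule sum_ennreal[symmetric]) (simp add: c_def)
    also have "\<dots> = (\<Sum>j\<le>N. ennreal (c j) * indicator (ball p (R * exp (- real j))) z)"
      by (intro sum.cong refl) (auto simp: indicator_def)
    finally show "ennreal ((norm (bump_grad p R N z))\<^sup>2) * indicator (ball 0 1) z \<le>
        (\<Sum>j\<le>N. ennreal (c j) * indicator (ball p (R * exp (- real j))) z)"
      by (auto simp: indicator_def split: if_splits)
  qed
  also have "\<dots> = (\<Sum>j\<le>N. ennreal (c j) * emeasure lborel (ball p (R * exp (- real j))))"
    by (subst nn_integral_sum) (auto simp: nn_integral_cmult_indicator
        intro!: borel_measurable_times_ennreal borel_measurable_indicator)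
  also have "\<dots> = (\<Sum>j\<le>N. ennreal (64 * pi * exp 2 / (real N)\<^sup>2))"
  proof (intro sum.cong refl)
    fix j
    have "c j * (pi * (R * exp (- real j))\<^sup>2) = 64 * pi * exp 2 / (real N)\<^sup>2"
      using R by (simp add: c_def power_mult_distrib exp_minus exp_add field_simps exp_double[of "real j", symmetric])
    moreover have "emeasure lborel (ball p (R * exp (- real j))) = ennreal (pi * (R * exp (- real j))\<^sup>2)"
      using R by (subst emeasure_ball) (auto simp: unit_ball_vol_2)
    ultimately show "ennreal (c j) * emeasure lborel (ball p (R * exp (- real j))) = ennreal (64 * pi * exp 2 / (real N)\<^sup>2)"
      by (simp add: c_def flip: ennreal_mult')
  qed
  also have "\<dots> = ennreal (\<Sum>j\<le>N. 64 * pi * exp 2 / (real N)\<^sup>2)"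
    by (rule sum_ennreal) simp
  also have "\<dots> \<le> ennreal (128 * pi * exp 2 / real N)"
  proof (rule ennreal_leI)
    have "(\<Sum>j\<le>N. 64 * pi * exp 2 / (real N)\<^sup>2) = (64 * pi * exp 2 / (real N)\<^sup>2) * (real N + 1)"
      by simp
    also have "\<dots> \<le> (64 * pi * exp 2 / (real N)\<^sup>2) * (2 * real N)"
      using N by (intro mult_left_mono) auto
    also have "\<dots> = 128 * pi * exp 2 / real N"
      using N by (simp add: power2_eq_square)
    finally show "(\<Sum>j\<le>N. 64 * pi * exp 2 / (real N)\<^sup>2) \<le> 128 * pi * exp 2 / real N" .
  qed
  finally show ?thesis .
qed

end

section \<open>Upper bound for well separated arcs\<close>

lemma tendsto_radial:
  assumes "continuous_on UNIV (v :: complex \<Rightarrow> real)"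
  shows "((\<lambda>r. v (of_real r * \<zeta>)) \<longlongrightarrow> v \<zeta>) (at_left (1::real))"
proof -
  have "isCont (\<lambda>r::real. v (of_real r * \<zeta>)) 1"
    by (intro continuous_on_interior[of UNIV] continuous_on_compose2[OF assms] continuous_intros) auto
  then have "((\<lambda>r. v (of_real r * \<zeta>)) \<longlongrightarrow> v (of_real 1 * \<zeta>)) (at (1::real))"
    by (simp add: isCont_def)
  then show ?thesis
    by (auto intro: filterlim_mono at_le)
qed

text \<open>The competitor is the sum of the bumps. Centres at mutual distance at least
  \<open>2 * R\<close> make the supports of the gradients disjoint, so energies add; centres on the
  circle and \<open>R \<le> 1 - r\<close> make every bump vanish on
  \<open>cball 0 r\<close>.\<close>

lemma condenser_cap_separated_le:
  fixes P :: "nat \<Rightarrow> complex"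
  assumes R: "R > 0" "R \<le> 1 - r" and N: "N \<ge> 1" and r: "0 < r"
    and P: "\<And>k. k < n \<Longrightarrow> norm (P k) = 1"
    and sep: "\<And>j k. j < n \<Longrightarrow> k < n \<Longrightarrow> j \<noteq> k \<Longrightarrow> 2 * R \<le> dist (P j) (P k)"
    and E: "E \<subseteq> sphere 0 1" "E \<subseteq> (\<Union>k<n. cball (P k) (R * exp (- real N)))"
  shows "condenser_cap E (cball 0 r) \<le> ennreal (real n * (128 * pi * exp 2 / real N))"
proof -
  define u where "u = (\<lambda>z. \<Sum>k<n. bump (P k) R N z)"
  define D where "D = (\<lambda>z. \<Sum>k<n. bump_grad (P k) R N z)"
  have D: "GDERIV u z :> D z" for z
    unfolding u_def D_def by (intro GDERIV_sum bump_GDERIV R N)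
  have cont: "continuous_on A u" "continuous_on A D" for A
    unfolding u_def D_def by (intro continuous_on_sum continuous_on_bump continuous_on_bump_grad R N)+
  have "C1_on_disc u"
    by (rule C1_on_discI[OF D cont(2)])
  moreover have "\<exists>l\<ge>1. ((\<lambda>r. ereal (u (of_real r * \<zeta>))) \<longlongrightarrow> l) (at_left 1)" if \<zeta>: "\<zeta> \<in> E" for \<zeta>
  proof -
    obtain k where k: "k < n" "dist \<zeta> (P k) \<le> R * exp (- real N)"
      using E \<zeta> by (auto simp: dist_commute)
    then have "1 = bump (P k) R N \<zeta>"
      using bump_eq_1 R N by simp
    also have "\<dots> \<le> u \<zeta>"
      unfolding u_def using k by (intro member_le_sum bump_bounds R N) auto
    finally have "1 \<le> ereal (u \<zeta>)" by (simp add: one_ereal_def)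
    then show ?thesis
      using tendsto_radial[OF cont(1), of \<zeta>] by (intro exI[of _ "ereal (u \<zeta>)"]) auto
  qed
  moreover have "u z \<le> 0" if "z \<in> cball 0 r" for z
  proof -
    have "R \<le> dist z (P k)" if "k < n" for k
    proof -
      have "norm (P k) \<le> norm z + dist z (P k)"
        using norm_triangle_sub[of "P k" z] by (simp add: dist_norm norm_minus_commute)
      then show ?thesis using P[OF that] \<open>z \<in> cball 0 r\<close> R by simp
    qed
    then show ?thesis
      unfolding u_def by (intro sum_nonpos) (auto simp: bump_eq_0[OF R(1) N])
  qed
  ultimately have "condenser_admissible E (cball 0 r) u"
    using E R by (subst condenser_admissible_iff) auto
  then have "condenser_cap E (cball 0 r) \<le> dirichlet_energy u"
    by (rule condenser_cap_le)
  also have "\<dots> \<le> (\<integral>\<^sup>+z. (\<Sum>k<n. ennreal ((norm (gradient (bump (P k) R N) z))\<^sup>2) * indicator (ball 0 1) z) \<partial>lborel)"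
    unfolding dirichlet_energy_def
  proof (intro nn_integral_mono)
    fix z :: complex
    have "(norm (D z))\<^sup>2 \<le> (\<Sum>k<n. (norm (bump_grad (P k) R N z))\<^sup>2)"
      unfolding D_def
    proof (rule power2_norm_sum_of_at_most_one_nonzero)
      fix i j assume "i \<in> {..<n}" "j \<in> {..<n}" "i \<noteq> j"
      then have "2 * R \<le> dist (P i) (P j)"
        using sep by auto
      also have "\<dots> \<le> dist z (P i) + dist z (P j)"
        using dist_triangle3 by blast
      finally have "R \<le> dist z (P i) \<or> R \<le> dist z (P j)"
        by linarith
      then show "bump_grad (P i) R N z = 0 \<or> bump_grad (P j) R N z = 0"
        using bump_grad_eq_0 R N by blast
    qed
    then have "ennreal ((norm (gradient u z))\<^sup>2) \<le> (\<Sum>k<n. ennreal ((norm (gradient (bump (P k) R N) z))\<^sup>2))"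
      unfolding gradient_eqI[OF D] bump_gradient[OF R(1) N]
      by (subst sum_ennreal) (auto intro: ennreal_leI)
    then show "ennreal ((norm (gradient u z))\<^sup>2) * indicator (ball 0 1) z
        \<le> (\<Sum>k<n. ennreal ((norm (gradient (bump (P k) R N) z))\<^sup>2) * indicator (ball 0 1) z)"
      unfolding sum_distrib_right[symmetric] by (rule mult_right_mono) simp
  qed
  also have "\<dots> = (\<Sum>k<n. dirichlet_energy (bump (P k) R N))"
    unfolding dirichlet_energy_def
    using borel_measurable_gradient_sq[OF bump_C1_on_disc[OF R(1) N]]
    by (intro nn_integral_sum) auto
  also have "\<dots> \<le> (\<Sum>k<n. ennreal (128 * pi * exp 2 / real N))"
    by (intro sum_mono dirichlet_energy_bump_le R N)
  also have "\<dots> = ennreal (real n * (128 * pi * exp 2 / real N))"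
    by (subst sum_ennreal) auto
  finally show ?thesis .
qed

subsection \<open>A lower bound by extremal length\<close>

text \<open>The finite exceptional set \<open>S\<close> is there for the corner that the curves have
  at the depth where they start to fan out.\<close>

lemma curve_length_bound:
  fixes \<gamma> :: "real \<Rightarrow> complex"
  assumes u: "C1_on_disc u" and S: "finite S" and "a \<le> b"
    and cont: "continuous_on {a..b} \<gamma>" and img: "\<And>t. t \<in> {a..b} \<Longrightarrow> \<gamma> t \<in> ball 0 1"
    and deriv: "\<And>t. t \<in> {a..b} - S \<Longrightarrow> (\<gamma> has_vector_derivative \<gamma>' t) (at t)"
    and bound: "\<And>t. t \<in> {a..b} - S \<Longrightarrow> norm (\<gamma>' t) \<le> L"
  shows "ennreal (u (\<gamma> a) - u (\<gamma> b)) \<le> (\<integral>\<^sup>+t\<in>{a..b}. ennreal (\<bar>L\<bar> * norm (gradient u (\<gamma> t))) \<partial>lborel)"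
proof -
  \<comment> \<open>Nothing is known about \<open>\<gamma>'\<close> on \<open>S\<close>; the value 0
    there makes the comparison with \<open>g\<close> hold on the whole interval.\<close>
  define f' where "f' = (\<lambda>t. if t \<in> S then 0 else \<gamma>' t \<bullet> gradient u (\<gamma> t))"
  define g where "g = (\<lambda>t. \<bar>L\<bar> * norm (gradient u (\<gamma> t)))"
  have "(f' has_integral u (\<gamma> b) - u (\<gamma> a)) {a..b}"
  proof (rule fundamental_theorem_of_calculus_strong[OF S \<open>a \<le> b\<close>])
    fix t assume t: "t \<in> {a..b} - S"
    have "(u has_derivative (\<lambda>h. h \<bullet> gradient u (\<gamma> t))) (at (\<gamma> t))"
      using C1_on_disc_GDERIV[OF u img] t unfolding gderiv_def by auto
    from has_derivative_compose[OF deriv[OF t, unfolded has_vector_derivative_def] this]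
    show "((\<lambda>t. u (\<gamma> t)) has_vector_derivative f' t) (at t)"
      using t by (simp add: has_vector_derivative_def f'_def)
  next
    show "continuous_on {a..b} (\<lambda>t. u (\<gamma> t))"
      by (rule continuous_on_compose2[OF C1_on_disc_continuous_on[OF u] cont]) (use img in auto)
  qed
  then have f': "f' integrable_on {a..b}" "integral {a..b} f' = u (\<gamma> b) - u (\<gamma> a)"
    by (auto simp: has_integral_iff)
  have "continuous_on {a..b} g"
    unfolding g_def
    by (intro continuous_intros continuous_on_compose2[OF C1_on_disc_continuous_on_gradient[OF u] cont])
      (use img in auto)
  then have g: "g integrable_on {a..b}"
    by (rule integrable_continuous_interval)
  have "norm (integral {a..b} f') \<le> integral {a..b} g"
  proof (rule integral_norm_bound_integral[OF f'(1) g])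
    fix t assume t: "t \<in> {a..b}"
    show "norm (f' t) \<le> g t"
    proof (cases "t \<in> S")
      case False
      have "norm (f' t) \<le> norm (\<gamma>' t) * norm (gradient u (\<gamma> t))"
        using False Cauchy_Schwarz_ineq2 by (auto simp: f'_def)
      also have "\<dots> \<le> \<bar>L\<bar> * norm (gradient u (\<gamma> t))"
        using bound[of t] t False by (intro mult_right_mono) auto
      finally show ?thesis by (simp add: g_def)
    qed (simp add: f'_def g_def)
  qed
  then have "ennreal (u (\<gamma> a) - u (\<gamma> b)) \<le> ennreal (integral {a..b} g)"
    using f' by (intro ennreal_leI) auto
  also have "\<dots> = (\<integral>\<^sup>+t. ennreal (g t) * indicator {a..b} t \<partial>lborel)"
    by (rule nn_integral_has_integral_lebesgue'[symmetric, OF _ integrable_integral[OF g]]) (simp add: g_def)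
  finally show ?thesis by (simp add: g_def)
qed

text \<open>The curves \<open>t \<mapsto> (1 - t) slope_pt (a + x * fan n d t)\<close>, \<open>x \<in> {0..1}\<close>, end radially on an arc
  of slope length \<open>d\<close> and fan out to slope length about \<open>1 / n\<close> at depth \<open>t \<ge> 1 / n\<close>. They have to be
  radial near the circle because only radial limits of admissible functions are controlled.\<close>

definition fan :: "real \<Rightarrow> real \<Rightarrow> real \<Rightarrow> real" where
  "fan n d t = max d t / (1 + n * (max d t - d))"

context
  fixes n d :: real
  assumes n: "1 \<le> n" and d: "0 < d" "n * d \<le> 1"
begin

private lemma fan_denom: "1 \<le> 1 + n * (max d t - d)"
  using n by simp

lemma fan_pos: "0 < fan n d t"
  unfolding fan_def using fan_denom[of t] d by (intro divide_pos_pos) auto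

text \<open>After multiplying out, this is just \<open>n * d \<le> 1\<close>. It confines the fan
  starting at slope \<open>k / n\<close> to the slopes up to \<open>(k + 1) / n\<close>, so
  different fans do not overlap.\<close>

lemma fan_le: "fan n d t \<le> 1 / n"
proof -
  have "n * max d t \<le> 1 + n * (max d t - d)"
    using d unfolding right_diff_distrib by linarith
  then have "max d t \<le> (1 / n) * (1 + n * (max d t - d))"
    using n mult_left_mono[of "n * max d t" "1 + n * (max d t - d)" "1 / n"] by simp
  then show ?thesis
    unfolding fan_def using fan_denom[of t] by (subst pos_divide_le_eq) auto
qed

lemma fan_eq: "t \<le> d \<Longrightarrow> fan n d t = d"
  by (simp add: fan_def)

lemma continuous_on_fan: "continuous_on A (fan n d)"
  unfolding fan_def using fan_denom by (intro continuous_intros) (metis not_one_le_zero)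

text \<open>Beyond the corner the derivative is \<open>(1 - n * d) / q\<^sup>2\<close> with
  \<open>q \<ge> 1\<close>. Being at most 1, it adds at most 1 to the unit radial speed of the
  curves.\<close>

lemma DERIV_fan:
  assumes "t \<noteq> d"
  shows "\<exists>D. (fan n d has_real_derivative D) (at t) \<and> \<bar>D\<bar> \<le> 1"
proof (cases "t < d")
  case True
  have "(fan n d has_real_derivative 0) (at t)"
    by (rule has_field_derivative_transform_within_open[of "\<lambda>_. d" _ _ "{..<d}"])
      (use True fan_eq in auto)
  then show ?thesis by force
next
  case False
  define q where "q = 1 + n * (t - d)"
  have q: "1 \<le> q"
    using False n by (simp add: q_def)
  have "((\<lambda>t. t / (1 + n * (t - d))) has_real_derivative (1 - n * d) / q\<^sup>2) (at t)"
    using q unfolding q_def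
    by (auto intro!: derivative_eq_intros simp: power2_eq_square algebra_simps)
  then have "(fan n d has_real_derivative (1 - n * d) / q\<^sup>2) (at t)"
    by (rule has_field_derivative_transform_within_open[of _ _ _ "{d<..}"])
      (use False assms in \<open>auto simp: fan_def\<close>)
  moreover have "0 \<le> n * d" "1 \<le> q\<^sup>2"
    using n d q by simp_all
  then have "\<bar>(1 - n * d) / q\<^sup>2\<bar> \<le> 1"
    using d by (simp add: divide_le_eq_1)
  ultimately show ?thesis by blast
qed

text \<open>This is the extremal length of the family of fans. The radial part contributes
  \<open>1 / n\<close>; beyond it \<open>1 / (n * fan n d t) \<le> 1 / (n * t) + 1\<close>, whose
  logarithmic integral stays bounded when \<open>ln (1 / d)\<close> is of order
  \<open>n\<close>.\<close>

lemma nn_integral_inverse_fan: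
  assumes "d \<le> 1 / 2"
  shows "(\<integral>\<^sup>+t\<in>{0..1/2}. ennreal (1 / (n * fan n d t)) \<partial>lborel) \<le> ennreal ((1 + ln (1 / d)) / n + 1 / 2)"
proof -
  have *: "ennreal (1 / (n * fan n d t)) * indicator {0..1/2} t \<le>
     ennreal (1 / (n * d)) * indicator {0..d} t + ennreal (1 / (n * t) + 1) * indicator {d..1/2} t" for t
  proof -
    have "1 / (n * fan n d t) \<le> 1 / (n * t) + 1" if "d \<le> t"
    proof -
      have "1 / (n * fan n d t) = (1 + n * (t - d)) / (n * t)"
        using that by (simp add: fan_def max_absorb2)
      also have "\<dots> \<le> (1 + n * t) / (n * t)"
        using that n d by (intro divide_right_mono) (auto simp: algebra_simps)
      also have "\<dots> = 1 / (n * t) + 1"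
        using that n d by (simp add: add_divide_distrib)
      finally show ?thesis .
    qed
    then have "d \<le> t \<Longrightarrow> ennreal (1 / (n * fan n d t)) \<le> ennreal (1 / (n * t) + 1)"
      by (rule ennreal_leI)
    then show ?thesis
      by (auto simp: indicator_def fan_eq intro: order_trans[OF _ add_increasing])
  qed
  have "(\<integral>\<^sup>+t\<in>{0..1/2}. ennreal (1 / (n * fan n d t)) \<partial>lborel) \<le>
      (\<integral>\<^sup>+t. ennreal (1 / (n * d)) * indicator {0..d} t + ennreal (1 / (n * t) + 1) * indicator {d..1/2} t \<partial>lborel)"
    by (intro nn_integral_mono *)
  also have "\<dots> = (\<integral>\<^sup>+t. ennreal (1 / (n * d)) * indicator {0..d} t \<partial>lborel) +
      (\<integral>\<^sup>+t. ennreal (1 / (n * t) + 1) * indicator {d..1/2} t \<partial>lborel)"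
    by (intro nn_integral_add) measurable
  also have "(\<integral>\<^sup>+t. ennreal (1 / (n * d)) * indicator {0..d} t \<partial>lborel) = ennreal (1 / n)"
    using d n by (simp add: nn_integral_cmult_indicator flip: ennreal_mult')
  also have "(\<integral>\<^sup>+t. ennreal (1 / (n * t) + 1) * indicator {d..1/2} t \<partial>lborel) =
      ennreal ((ln (1/2) / n + 1/2) - (ln d / n + d))"
    using n d assms by (intro nn_integral_FTC_Icc) (auto intro!: derivative_eq_intros simp: field_simps)
  also have "ennreal (1 / n) + ennreal ((ln (1/2) / n + 1/2) - (ln d / n + d)) =
      ennreal (1 / n + ((ln (1/2) / n + 1/2) - (ln d / n + d)))"
  proof (rule ennreal_plus[symmetric])
    have "ln d / n \<le> ln (1/2) / n"
      using n d assms by (intro divide_right_mono ln_mono) auto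
    then show "0 \<le> (ln (1/2) / n + 1/2) - (ln d / n + d)"
      using assms by simp
  qed (use n in simp)
  also have "\<dots> \<le> ennreal ((1 + ln (1 / d)) / n + 1 / 2)"
  proof (rule ennreal_leI)
    have "ln (1/2) / n \<le> 0"
      using n by (intro divide_nonpos_nonneg) (auto simp: ln_div)
    moreover have "(1 + ln (1 / d)) / n = 1 / n - ln d / n"
      using d by (simp add: ln_div add_divide_distrib diff_divide_distrib)
    ultimately show "1 / n + ((ln (1/2) / n + 1/2) - (ln d / n + d)) \<le> (1 + ln (1 / d)) / n + 1 / 2"
      using d by simp
  qed
  finally show ?thesis .
qed

text \<open>Along the curve \<open>u\<close> climbs from at most 0 at depth \<open>1 / 2\<close> to
  nearly 1 near the circle, at speed at most 2. The limit may be infinite and \<open>u\<close> is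
  regular only inside the disc, so the curve is cut at a depth \<open>\<tau> > 0\<close> and the
  bound is obtained by contradiction from a real \<open>y < 1\<close>. The indicator removes the end
  point on the circle.\<close>

lemma fan_curve_bound:
  assumes u: "C1_on_disc u" and d': "d \<le> 1 / 2" and x: "x \<in> {0..1}"
    and lim: "((\<lambda>r. ereal (u (of_real r * slope_pt (a + x * d)))) \<longlongrightarrow> l) (at_left 1)" "1 \<le> l"
    and F: "\<And>z. z \<in> cball 0 (1/2) \<Longrightarrow> u z \<le> 0"
  shows "1 \<le> (\<integral>\<^sup>+t\<in>{0..1/2}. ennreal (2 * (norm (gradient u (of_real (1 - t) * slope_pt (a + x * fan n d t)))
     * indicator (ball 0 1) (of_real (1 - t) * slope_pt (a + x * fan n d t) :: complex))) \<partial>lborel)"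
    (is "1 \<le> ?I")
proof -
  define \<gamma> where "\<gamma> = (\<lambda>t. of_real (1 - t) * slope_pt (a + x * fan n d t))"
  have fold_\<gamma>: "of_real (1 - t) * slope_pt (a + x * fan n d t) = \<gamma> t" for t
    by (simp add: \<gamma>_def)
  have norm_\<gamma>: "norm (\<gamma> t) = \<bar>1 - t\<bar>" for t
    unfolding \<gamma>_def norm_mult norm_of_real by simp
  have cont: "continuous_on A \<gamma>" for A
    unfolding \<gamma>_def by (intro continuous_intros continuous_on_fan)
  have deriv: "\<exists>D. (\<gamma> has_vector_derivative D) (at t) \<and> norm D \<le> 2" if t: "t \<in> {0..1/2} - {d}" for t
  proof -
    obtain D where D: "(fan n d has_real_derivative D) (at t)" "\<bar>D\<bar> \<le> 1"
      using DERIV_fan t by blast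
    define m where "m = a + x * fan n d t"
    have "((\<lambda>t. a + x * fan n d t) has_real_derivative x * D) (at t)"
      using DERIV_add[OF DERIV_const DERIV_cmult[OF D(1)], of a x] by simp
    then have "((\<lambda>t. slope_pt (a + x * fan n d t)) has_vector_derivative
        (x * D) *\<^sub>R (\<i> * slope_pt m * of_real (inverse (1 + m\<^sup>2)))) (at t)"
      using vector_diff_chain_at[OF _ slope_pt_has_vector_derivative, of "\<lambda>t. a + x * fan n d t" "x * D" t]
      by (simp add: has_real_derivative_iff_has_vector_derivative o_def m_def)
    moreover have "((\<lambda>t. of_real (1 - t) :: complex) has_vector_derivative - 1) (at t)"
      by (auto intro!: derivative_eq_intros)
    ultimately have "(\<gamma> has_vector_derivative
        (of_real (1 - t) * ((x * D) *\<^sub>R (\<i> * slope_pt m * of_real (inverse (1 + m\<^sup>2)))) + (- 1) * slope_pt m)) (at t)"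
      unfolding \<gamma>_def m_def by (intro has_vector_derivative_mult)
    moreover have "norm (of_real (1 - t) * ((x * D) *\<^sub>R (\<i> * slope_pt m * of_real (inverse (1 + m\<^sup>2)))) + (- 1) * slope_pt m) \<le> 2"
    proof -
      have "norm (of_real (1 - t) * ((x * D) *\<^sub>R (\<i> * slope_pt m * of_real (inverse (1 + m\<^sup>2))))) =
          \<bar>1 - t\<bar> * (\<bar>x\<bar> * \<bar>D\<bar> * \<bar>inverse (1 + m\<^sup>2)\<bar>)"
        unfolding norm_mult norm_scaleR norm_of_real by (simp add: abs_mult)
      also have "\<dots> \<le> 1 * (1 * 1 * 1)"
        using t x D by (intro mult_mono) (auto simp: inverse_le_1_iff)
      finally show ?thesis
        using norm_triangle_ineq[of "of_real (1 - t) * ((x * D) *\<^sub>R (\<i> * slope_pt m * of_real (inverse (1 + m\<^sup>2))))" "(- 1) * slope_pt m"]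
        by simp
    qed
    ultimately show ?thesis by blast
  qed
  then obtain \<gamma>' where \<gamma>': "\<And>t. t \<in> {0..1/2} - {d} \<Longrightarrow> (\<gamma> has_vector_derivative \<gamma>' t) (at t) \<and> norm (\<gamma>' t) \<le> 2"
    by metis
  have est: "ennreal (u (\<gamma> \<tau>)) \<le> ?I" if \<tau>: "0 < \<tau>" "\<tau> \<le> 1/2" for \<tau>
  proof -
    have "u (\<gamma> (1/2)) \<le> 0"
      by (intro F) (simp add: norm_\<gamma>)
    then have "ennreal (u (\<gamma> \<tau>)) \<le> ennreal (u (\<gamma> \<tau>) - u (\<gamma> (1/2)))"
      by (intro ennreal_leI) simp
    also have "\<dots> \<le> (\<integral>\<^sup>+t\<in>{\<tau>..1/2}. ennreal (\<bar>2\<bar> * norm (gradient u (\<gamma> t))) \<partial>lborel)"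
      by (rule curve_length_bound[OF u, of "{d}" _ _ _ \<gamma>']) (use \<tau> \<gamma>' cont in \<open>auto simp: norm_\<gamma>\<close>)
    also have "\<dots> \<le> ?I"
      unfolding fold_\<gamma>
      by (intro nn_integral_mono) (use \<tau> in \<open>auto simp: indicator_def norm_\<gamma>\<close>)
    finally show ?thesis .
  qed
  show ?thesis
  proof (rule ccontr)
    assume "\<not> 1 \<le> ?I"
    then obtain y where y: "?I = ennreal y" "0 \<le> y" "y < 1"
      by (cases "?I") (auto simp: ennreal_less_iff not_le)
    have "ereal y < l"
      using y lim(2) by (metis ereal_less(3) less_le_trans one_ereal_def ereal_less_eq(3) less_ereal.simps(1))
    then have "eventually (\<lambda>r. ereal y < ereal (u (of_real r * slope_pt (a + x * d)))) (at_left 1)"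
      by (rule order_tendstoD(1)[OF lim(1)])
    \<comment> \<open>For such \<open>r\<close> the depth \<open>1 - r\<close> is below
      \<open>d\<close>, so the point lies on the radial piece of the curve, where the limit
      applies.\<close>
    moreover have "eventually (\<lambda>r::real. r \<in> {1 - d<..<1}) (at_left 1)"
      using d by (intro eventually_at_leftI[of "1 - d"]) auto
    ultimately have "eventually (\<lambda>r. ereal y < ereal (u (of_real r * slope_pt (a + x * d))) \<and> r \<in> {1 - d<..<1}) (at_left 1)"
      by eventually_elim simp
    then obtain r where r: "y < u (of_real r * slope_pt (a + x * d))" "1 - d < r" "r < 1"
      using eventually_happens'[of "at_left (1::real)"] by force
    have "\<gamma> (1 - r) = of_real r * slope_pt (a + x * d)"
      using r fan_eq[of "1 - r"] by (simp add: \<gamma>_def)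
    with r est[of "1 - r"] y d' show False
      by (auto simp: ennreal_le_iff2)
  qed
qed

end

text \<open>The bound \<open>fan_curve_bound\<close> is averaged over all curves; in place of Cauchy-Schwarz we use
  \<open>2 y \<le> 2 K b y\<^sup>2 + 1 / (2 K b)\<close> with \<open>b = n w(t)\<close>, where \<open>w\<close> is the Jacobian of the fan in slope and
  \<open>K\<close> bounds the integral of \<open>1 / b\<close>.\<close>

lemma dirichlet_energy_ge:
  fixes n :: nat
  assumes n: "1 \<le> n" and d: "0 < d" "real n * d \<le> 1" "d \<le> 1 / 2"
    and K: "(1 + ln (1 / d)) / real n + 1 / 2 \<le> K"
    and u: "condenser_admissible (slope_pt ` (\<Union>k<n. {real k / real n..real k / real n + d})) (cball 0 (1/2)) u"
  shows "ennreal (1 / (16 * K)) \<le> dirichlet_energy u"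
proof -
  define w where "w = fan (real n) d"
  have n': "1 \<le> real n" using n by simp
  note fan = fan_pos[OF n' d(1,2), folded w_def] fan_le[OF n' d(1,2), folded w_def]
  have [measurable]: "w \<in> borel_measurable borel"
    using continuous_on_fan[OF n' d(1,2)] by (auto simp: w_def intro: borel_measurable_continuous_onI)
  have "0 < (1 + ln (1 / d)) / real n + 1 / 2"
    using d n' by (intro add_nonneg_pos divide_nonneg_pos add_nonneg_nonneg ln_ge_zero) (auto simp: field_simps)
  then have K0: "0 < K" using K by simp
  have "cball 0 (1/2) \<subseteq> ball (0::complex) 1" by auto
  then have u': "C1_on_disc u" "\<And>z. z \<in> cball 0 (1/2) \<Longrightarrow> u z \<le> 0"
    and lim: "\<And>\<zeta>. \<zeta> \<in> slope_pt ` (\<Union>k<n. {real k / real n..real k / real n + d}) \<Longrightarrow>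
      \<exists>l\<ge>1. ((\<lambda>r. ereal (u (of_real r * \<zeta>))) \<longlongrightarrow> l) (at_left 1)"
    using u by (subst (asm) condenser_admissible_iff; force)+
  define g where "g = (\<lambda>z. norm (gradient u z) * indicator (ball 0 1) z)"
  have "(\<lambda>z. indicator (ball 0 1) z *\<^sub>R norm (gradient u z)) \<in> borel_measurable borel"
    by (intro borel_measurable_continuous_on_indicator continuous_intros
        C1_on_disc_continuous_on_gradient u'(1)) auto
  then have [measurable]: "g \<in> borel_measurable borel"
    by (simp add: g_def mult.commute)
  have g0: "0 \<le> g z" for z by (simp add: g_def)
  define P where "P = (\<lambda>t m. of_real (1 - t) * slope_pt m)"
  have [measurable]: "case_prod P \<in> borel \<Otimes>\<^sub>M borel \<rightarrow>\<^sub>M borel"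
    unfolding P_def by measurable
  define q where "q = (\<lambda>z. ennreal ((g z)\<^sup>2))"
  have [measurable]: "q \<in> borel_measurable borel"
    unfolding q_def by measurable
  have energy: "dirichlet_energy u = (\<integral>\<^sup>+z. q z \<partial>lborel)"
    unfolding dirichlet_energy_def q_def g_def
    by (intro nn_integral_cong) (auto simp: indicator_def)
  define J where "J = (\<lambda>k. (\<integral>\<^sup>+x\<in>{0..1}. \<integral>\<^sup>+t\<in>{0..1/2}. ennreal (w t) * q (P t (real k / real n + x * w t)) \<partial>lborel \<partial>lborel))"
  define I where "I = (\<integral>\<^sup>+t\<in>{0..1/2}. ennreal (1 / (real n * w t)) \<partial>lborel)"
  have I: "I \<le> ennreal K"
    using nn_integral_inverse_fan[OF n' d(1,2,3)] ennreal_leI[OF K] unfolding I_def w_def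
    by (rule order_trans)

  \<comment> \<open>The second term of the quadratic inequality integrates to at most
    \<open>1 / (2 * K) * K = 1 / 2\<close>; the other half of the unit climb must come from the
    energy.\<close>
  have curve: "1 \<le> ennreal (2 * K * real n) * (\<integral>\<^sup>+t\<in>{0..1/2}. ennreal (w t) * q (P t (real k / real n + x * w t)) \<partial>lborel) + ennreal (1 / 2)"
    if k: "k < n" and x: "x \<in> {0..1}" for k x
  proof -
    have pt: "real k / real n + x * d \<in> {real k / real n..real k / real n + d}"
      using x d by (auto simp: mult_left_le_one_le)
    obtain l where l: "1 \<le> l" "((\<lambda>r. ereal (u (of_real r * slope_pt (real k / real n + x * d)))) \<longlongrightarrow> l) (at_left 1)"
      using lim[of "slope_pt (real k / real n + x * d)"] pt k by blast
    have "1 \<le> (\<integral>\<^sup>+t\<in>{0..1/2}. ennreal (2 * g (P t (real k / real n + x * w t))) \<partial>lborel)"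
      unfolding g_def P_def w_def
      by (rule fan_curve_bound[OF n' d(1,2) u'(1) d(3) x l(2,1) u'(2)])
    also have "\<dots> \<le> (\<integral>\<^sup>+t. ennreal (2 * K * real n) * (ennreal (w t) * q (P t (real k / real n + x * w t)) * indicator {0..1/2} t)
        + ennreal (1 / (2 * K)) * (ennreal (1 / (real n * w t)) * indicator {0..1/2} t) \<partial>lborel)"
    proof (intro nn_integral_mono)
      fix t :: real
      define y b where "y = g (P t (real k / real n + x * w t))" and "b = real n * w t"
      have b: "0 < b" using fan n' by (simp add: b_def)
      have "2 * y \<le> 2 * K * b * y\<^sup>2 + 1 / (2 * K * b)"
      proof -
        have "0 \<le> (2 * K * b * y - 1)\<^sup>2 / (2 * K * b)"
          using b K0 by simp
        also have "\<dots> = 2 * K * b * y\<^sup>2 + 1 / (2 * K * b) - 2 * y"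
          using b K0 by (simp add: power2_eq_square field_simps)
        finally show ?thesis by simp
      qed
      also have "\<dots> = (2 * K * real n) * (w t * y\<^sup>2) + 1 / (2 * K) * (1 / (real n * w t))"
        by (simp add: b_def)
      finally have "ennreal (2 * y) \<le> ennreal ((2 * K * real n) * (w t * y\<^sup>2) + 1 / (2 * K) * (1 / (real n * w t)))"
        by (rule ennreal_leI)
      also have "\<dots> = ennreal (2 * K * real n) * (ennreal (w t) * ennreal (y\<^sup>2)) + ennreal (1 / (2 * K)) * ennreal (1 / (real n * w t))"
        using K0 fan(1)[of t] n' ennreal_mult'[of "2 * K * real n" "w t * y\<^sup>2"] ennreal_mult'[of "w t" "y\<^sup>2"]
          ennreal_mult'[of "1 / (2 * K)" "1 / (real n * w t)"] by (subst ennreal_plus) simp_all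
      finally show "ennreal (2 * g (P t (real k / real n + x * w t))) * indicator {0..1/2} t \<le>
          ennreal (2 * K * real n) * (ennreal (w t) * q (P t (real k / real n + x * w t)) * indicator {0..1/2} t)
        + ennreal (1 / (2 * K)) * (ennreal (1 / (real n * w t)) * indicator {0..1/2} t)"
        by (auto simp: indicator_def q_def y_def)
    qed
    also have "\<dots> = ennreal (2 * K * real n) * (\<integral>\<^sup>+t\<in>{0..1/2}. ennreal (w t) * q (P t (real k / real n + x * w t)) \<partial>lborel)
        + ennreal (1 / (2 * K)) * I"
      unfolding I_def by (subst nn_integral_add) (simp_all add: nn_integral_cmult)
    also have "ennreal (1 / (2 * K)) * I \<le> ennreal (1 / (2 * K)) * ennreal K"
      by (intro mult_left_mono I) simp
    also have "\<dots> = ennreal (1 / 2)"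
      using K0 by (simp flip: ennreal_mult')
    finally show ?thesis by simp
  qed
  have J: "1 \<le> ennreal (2 * K * real n) * J k + ennreal (1 / 2)" if k: "k < n" for k
  proof -
    have "1 = (\<integral>\<^sup>+x\<in>{0..1::real}. 1 \<partial>lborel)"
      by simp
    also have "\<dots> \<le> (\<integral>\<^sup>+x. ennreal (2 * K * real n) * ((\<integral>\<^sup>+t\<in>{0..1/2}. ennreal (w t) * q (P t (real k / real n + x * w t)) \<partial>lborel) * indicator {0..1} x)
        + ennreal (1 / 2) * indicator {0..1} x \<partial>lborel)"
      using curve[OF k] by (intro nn_integral_mono) (auto simp: indicator_def)
    also have "\<dots> = ennreal (2 * K * real n) * J k + ennreal (1 / 2)"
      unfolding J_def by (subst nn_integral_add) (simp_all add: nn_integral_cmult nn_integral_cmult_indicator)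
    finally show ?thesis .
  qed
  \<comment> \<open>The substitution \<open>m = k / n + x * w t\<close> absorbs the weight
    \<open>w t\<close>, leaving a plain integral over the slopes which the \<open>k\<close>-th fan
    covers at depth \<open>t\<close>.\<close>
  have J_eq: "J k = (\<integral>\<^sup>+t\<in>{0..1/2}. (\<integral>\<^sup>+m. q (P t m) * indicator {real k / real n..real k / real n + w t} m \<partial>lborel) \<partial>lborel)" for k
  proof -
    have "J k = (\<integral>\<^sup>+x. \<integral>\<^sup>+t. ennreal (w t) * q (P t (real k / real n + x * w t)) * indicator {0..1/2} t * indicator {0..1} x \<partial>lborel \<partial>lborel)"
      unfolding J_def by (intro nn_integral_cong nn_integral_multc[symmetric]) measurable
    also have "\<dots> = (\<integral>\<^sup>+t. \<integral>\<^sup>+x. ennreal (w t) * q (P t (real k / real n + x * w t)) * indicator {0..1/2} t * indicator {0..1} x \<partial>lborel \<partial>lborel)"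
      by (rule lborel_pair.Fubini') measurable
    also have "\<dots> = (\<integral>\<^sup>+t. (\<integral>\<^sup>+m. q (P t m) * indicator {real k / real n..real k / real n + w t} m \<partial>lborel) * indicator {0..1/2} t \<partial>lborel)"
    proof (intro nn_integral_cong)
      fix t :: real
      have "(\<integral>\<^sup>+m. q (P t m) * indicator {real k / real n..real k / real n + w t} m \<partial>lborel) =
          ennreal \<bar>w t\<bar> * (\<integral>\<^sup>+x. q (P t (real k / real n + w t * x)) * indicator {real k / real n..real k / real n + w t} (real k / real n + w t * x) \<partial>lborel)"
        by (intro nn_integral_real_affine) (use fan(1)[of t] in auto)
      also have "(\<lambda>x. indicator {real k / real n..real k / real n + w t} (real k / real n + w t * x) :: ennreal) = indicator {0..1}"
        using fan(1)[of t] by (auto simp: fun_eq_iff indicator_def zero_le_mult_iff)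
      finally have *: "(\<integral>\<^sup>+m. q (P t m) * indicator {real k / real n..real k / real n + w t} m \<partial>lborel) =
          ennreal (w t) * (\<integral>\<^sup>+x. q (P t (real k / real n + w t * x)) * indicator {0..1} x \<partial>lborel)"
        using fan(1)[of t] by (simp add: fun_eq_iff)
      show "(\<integral>\<^sup>+x. ennreal (w t) * q (P t (real k / real n + x * w t)) * indicator {0..1/2} t * indicator {0..1} x \<partial>lborel) =
          (\<integral>\<^sup>+m. q (P t m) * indicator {real k / real n..real k / real n + w t} m \<partial>lborel) * indicator {0..1/2} t"
        unfolding * by (cases "t \<in> {0..1/2}") (simp_all add: nn_integral_cmult mult.assoc mult.commute[of _ "w t"])
    qed
    finally show ?thesis .
  qed
  have [measurable]: "Measurable.pred (borel \<Otimes>\<^sub>M borel)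
      (\<lambda>x. snd x \<in> {real k / real n..real k / real n + w (fst x)})" for k
    unfolding atLeastAtMost_iff by measurable
  have "(\<Sum>k<n. J k) = (\<integral>\<^sup>+t\<in>{0..1/2}. (\<Sum>k<n. \<integral>\<^sup>+m. q (P t m) * indicator {real k / real n..real k / real n + w t} m \<partial>lborel) \<partial>lborel)"
    unfolding J_eq sum_distrib_right by (rule nn_integral_sum[symmetric]) (measurable; simp)
  also have "\<dots> \<le> (\<integral>\<^sup>+t\<in>{0..1/2}. (\<integral>\<^sup>+m\<in>{0..1}. q (P t m) \<partial>lborel) \<partial>lborel)"
  proof (intro nn_integral_mono mult_right_mono)
    fix t :: real
    \<comment> \<open>Neighbouring closed intervals may share an end point. Half-open intervals of
      length \<open>1 / n\<close> contain them up to one point and are disjoint, so their indicators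
      add up to at most 1.\<close>
    have "(\<Sum>k<n. \<integral>\<^sup>+m. q (P t m) * indicator {real k / real n..real k / real n + w t} m \<partial>lborel) \<le>
        (\<Sum>k<n. \<integral>\<^sup>+m. q (P t m) * indicator {real k / real n..<real (Suc k) / real n} m \<partial>lborel)"
    proof (intro sum_mono nn_integral_mono_AE)
      fix k
      have le: "real k / real n + w t \<le> real (Suc k) / real n"
        using fan(2)[of t] by (simp add: add_divide_distrib)
      show "AE m in lborel. q (P t m) * indicator {real k / real n..real k / real n + w t} m \<le>
          q (P t m) * indicator {real k / real n..<real (Suc k) / real n} m"
        using AE_lborel_singleton[of "real (Suc k) / real n"]
        by eventually_elim (use le in \<open>auto simp: indicator_def\<close>)
    qed
    also have "\<dots> = (\<integral>\<^sup>+m. (\<Sum>k<n. q (P t m) * indicator {real k / real n..<real (Suc k) / real n} m) \<partial>lborel)"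
      by (rule nn_integral_sum[symmetric]) measurable
    also have "\<dots> \<le> (\<integral>\<^sup>+m\<in>{0..1}. q (P t m) \<partial>lborel)"
    proof (intro nn_integral_mono)
      fix m :: real
      have "(\<Sum>k<n. indicator {real k / real n..<real (Suc k) / real n} m :: ennreal) =
          indicator (\<Union>k<n. {real k / real n..<real (Suc k) / real n}) m"
      proof (rule indicator_UN_disjoint[symmetric])
        show "disjoint_family_on (\<lambda>k. {real k / real n..<real (Suc k) / real n}) {..<n}"
          unfolding disjoint_family_on_def
        proof safe
          fix i j x assume *: "i \<noteq> j" "x \<in> {real i / real n..<real (Suc i) / real n}" "x \<in> {real j / real n..<real (Suc j) / real n}"
          then have "real i < real (Suc j)" "real j < real (Suc i)"
            using n' by (auto simp: field_simps)
          with * show "x \<in> {}" by simp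
        qed
      qed simp
      also have "\<dots> \<le> indicator {0..1} m"
      proof -
        have "(\<Union>k<n. {real k / real n..<real (Suc k) / real n}) \<subseteq> {0..1}"
        proof safe
          fix k x assume *: "k < n" "x \<in> {real k / real n..<real (Suc k) / real n}"
          then have "real (Suc k) / real n \<le> 1" "0 \<le> real k / real n"
            by simp_all
          with * show "x \<in> {0..1}"
            unfolding atLeastAtMost_iff atLeastLessThan_iff by linarith
        qed
        then show ?thesis
          by (intro indicator_leI) blast
      qed
      finally show "(\<Sum>k<n. q (P t m) * indicator {real k / real n..<real (Suc k) / real n} m) \<le> q (P t m) * indicator {0..1} m"
        unfolding sum_distrib_left[symmetric] by (rule mult_left_mono) simp
    qed
    finally show "(\<Sum>k<n. \<integral>\<^sup>+m. q (P t m) * indicator {real k / real n..real k / real n + w t} m \<partial>lborel) \<le> (\<integral>\<^sup>+m\<in>{0..1}. q (P t m) \<partial>lborel)" .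
  qed simp
  also have "\<dots> \<le> 4 * dirichlet_energy u"
    unfolding energy P_def by (rule nn_integral_slope_polar) measurable
  finally have sumJ: "(\<Sum>k<n. J k) \<le> 4 * dirichlet_energy u" .

  \<comment> \<open>Summed over the \<open>n\<close> arcs, the estimates give
    \<open>n \<le> 2 * K * n * (4 * energy) + n / 2\<close>. Dividing by \<open>n\<close> leaves
    \<open>1 / (16 * K)\<close>, with no dependence on the number of arcs.\<close>
  have "ennreal (real n) = (\<Sum>k<n. 1)"
    by (simp add: ennreal_of_nat_eq_real_of_nat)
  also have "\<dots> \<le> (\<Sum>k<n. ennreal (2 * K * real n) * J k + ennreal (1 / 2))"
    by (intro sum_mono J) simp
  also have "\<dots> = ennreal (2 * K * real n) * (\<Sum>k<n. J k) + ennreal (real n / 2)"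
    unfolding sum.distrib sum_distrib_left by (subst sum_ennreal) auto
  also have "\<dots> \<le> ennreal (2 * K * real n) * (4 * dirichlet_energy u) + ennreal (real n / 2)"
    by (intro add_right_mono mult_left_mono sumJ) simp
  finally have main: "ennreal (real n) \<le> ennreal (2 * K * real n) * (4 * dirichlet_energy u) + ennreal (real n / 2)" .
  show ?thesis
  proof (cases "dirichlet_energy u")
    case (real e)
    have eq: "ennreal (2 * K * real n) * (4 * ennreal e) + ennreal (real n / 2) = ennreal (2 * K * real n * (4 * e) + real n / 2)"
      using real K0 ennreal_mult'[of "2 * K * real n" "4 * e"] ennreal_mult'[of 4 e]
      by (subst ennreal_plus) simp_all
    have "ennreal (real n) \<le> ennreal (2 * K * real n * (4 * e) + real n / 2)"
      using main unfolding real(2) eq .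
    then have "real n \<le> 2 * K * real n * (4 * e) + real n / 2"
      by (subst (asm) ennreal_le_iff) (use real K0 in auto)
    then have "real n * (1 / 2) \<le> real n * (8 * K * e)"
      by (simp add: algebra_simps)
    then have "1 / 2 \<le> 8 * K * e"
      using n' by (simp only: mult_le_cancel_left_pos)
    then have "1 / (16 * K) \<le> e"
      using K0 by (simp add: field_simps)
    then show ?thesis
      using real by (simp add: ennreal_leI)
  qed simp
qed

subsection \<open>Continuity of the capacity\<close>

text \<open>Young's inequality, kept with a parameter so that the first term can have a factor close
  to 1 at the expense of the second.\<close>

lemma power2_norm_add_le:
  fixes x y :: "'a::real_normed_vector"
  assumes "\<eta> > 0"
  shows "(norm (x + y))\<^sup>2 \<le> (1 + \<eta>) * (norm x)\<^sup>2 + (1 + 1 / \<eta>) * (norm y)\<^sup>2"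
proof -
  have "(norm (x + y))\<^sup>2 \<le> (norm x + norm y)\<^sup>2"
    by (intro power_mono norm_triangle_ineq) auto
  also have "\<dots> \<le> (1 + \<eta>) * (norm x)\<^sup>2 + (1 + 1 / \<eta>) * (norm y)\<^sup>2"
  proof -
    have "0 \<le> (\<eta> * norm x - norm y)\<^sup>2 / \<eta>"
      using assms by simp
    also have "\<dots> = (1 + \<eta>) * (norm x)\<^sup>2 + (1 + 1 / \<eta>) * (norm y)\<^sup>2 - (norm x + norm y)\<^sup>2"
      using assms by (simp add: power2_eq_square field_simps)
    finally show ?thesis by simp
  qed
  finally show ?thesis .
qed

text \<open>A bounded function with slope close to 1: composing an admissible function with it makes
  products with a cutoff have radial limits even where the admissible function has none.\<close>

definition squash :: "real \<Rightarrow> real \<Rightarrow> real" where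
  "squash \<kappa> s = arctan (\<kappa> * s) / arctan \<kappa>"

text \<open>\<open>M\<close> is a C1 substitute for the maximum of \<open>u\<close> and
  \<open>v\<close>. On \<open>A\<close> the factor \<open>1 - v\<close> tends to 0 and the other one
  is bounded, so no limit of \<open>u\<close> is needed; on the rest of \<open>E\<close> the limits
  \<open>c \<ge> 1\<close> of \<open>squash \<kappa> u\<close> and \<open>v \<zeta> \<le> 1\<close>
  give \<open>1 - (1 - c) * (1 - v \<zeta>) \<ge> 1\<close>; on \<open>F\<close> only
  \<open>squash \<kappa> u \<le> 0\<close> remains.\<close>

lemma condenser_cap_Un_le_squash:
  assumes \<kappa>: "\<kappa> > 0" and \<eta>: "\<eta> > 0"
    and sub: "E \<subseteq> sphere 0 1" "A \<subseteq> sphere 0 1" "F \<subseteq> ball 0 1"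
    and u: "condenser_admissible E F u"
    and v: "C1_on_disc v" "continuous_on UNIV v" "\<And>z. 0 \<le> v z" "\<And>z. v z \<le> 1"
      "\<And>z. z \<in> A \<Longrightarrow> v z = 1" "\<And>z. z \<in> F \<Longrightarrow> v z = 0"
  shows "condenser_cap (E \<union> A) F \<le>
    ennreal ((1 + \<eta>) * (\<kappa> / arctan \<kappa>)\<^sup>2) * dirichlet_energy u +
    ennreal ((1 + 1 / \<eta>) * (1 + 2 / arctan \<kappa>)\<^sup>2) * dirichlet_energy v"
proof -
  have a: "0 < arctan \<kappa>" using \<kappa> by simp
  have u': "C1_on_disc u" "\<And>z. z \<in> F \<Longrightarrow> u z \<le> 0"
    "\<And>\<zeta>. \<zeta> \<in> E \<Longrightarrow> \<exists>l\<ge>1. ((\<lambda>r. ereal (u (of_real r * \<zeta>))) \<longlongrightarrow> l) (at_left 1)"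
    using u sub by (auto simp: condenser_admissible_iff)
  have bnd: "\<bar>squash \<kappa> s\<bar> \<le> 2 / arctan \<kappa>" for s
  proof -
    have "\<bar>arctan (\<kappa> * s)\<bar> \<le> 2"
      using arctan_bounded[of "\<kappa> * s"] pi_less_4 by linarith
    then show ?thesis
      using a unfolding squash_def by (simp add: divide_right_mono)
  qed
  define M where "M = (\<lambda>z. 1 - (1 - squash \<kappa> (u z)) * (1 - v z))"
  define h' where "h' = (\<lambda>s. \<kappa> / arctan \<kappa> * inverse (1 + (\<kappa> * s)\<^sup>2))"
  define D where "D = (\<lambda>z. ((1 - v z) * h' (u z)) *\<^sub>R gradient u z + (1 - squash \<kappa> (u z)) *\<^sub>R gradient v z)"
  have h': "(squash \<kappa> has_real_derivative h' s) (at s)" for s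
  proof -
    have "((\<lambda>s. arctan (\<kappa> * s)) has_real_derivative inverse (1 + (\<kappa> * s)\<^sup>2) * \<kappa>) (at s)"
      by (rule DERIV_chain2[OF DERIV_arctan]) (auto intro!: derivative_eq_intros)
    from DERIV_cdivide[OF this, of "arctan \<kappa>"] show ?thesis
      unfolding squash_def[abs_def] h'_def by (simp add: mult_ac)
  qed
  have h'_bnd: "\<bar>h' s\<bar> \<le> \<kappa> / arctan \<kappa>" for s
  proof -
    have "inverse (1 + (\<kappa> * s)\<^sup>2) \<le> 1"
      by (simp add: inverse_le_1_iff)
    then have "\<kappa> / arctan \<kappa> * inverse (1 + (\<kappa> * s)\<^sup>2) \<le> \<kappa> / arctan \<kappa> * 1"
      using a \<kappa> by (intro mult_left_mono) auto
    then show ?thesis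
      using a \<kappa> by (simp add: h'_def abs_mult)
  qed
  have D: "GDERIV M z :> D z" if z: "z \<in> ball 0 1" for z
  proof -
    have 1: "GDERIV (\<lambda>z. 1 - squash \<kappa> (u z)) z :> 0 - h' (u z) *\<^sub>R gradient u z"
      by (intro GDERIV_diff GDERIV_const GDERIV_DERIV_compose[OF _ h'] C1_on_disc_GDERIV u' z)
    have 2: "GDERIV (\<lambda>z. 1 - v z) z :> 0 - gradient v z"
      by (intro GDERIV_diff GDERIV_const C1_on_disc_GDERIV v z)
    from GDERIV_diff[OF GDERIV_const GDERIV_mult[OF 1 2], of 1]
    show ?thesis
      unfolding M_def D_def by (simp add: scaleR_diff_right)
  qed
  have "continuous_on (ball 0 1) D"
    unfolding D_def h'_def squash_def
    by (intro continuous_intros C1_on_disc_continuous_on C1_on_disc_continuous_on_gradient u' v)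
      (use a in \<open>auto simp: add_nonneg_eq_0_iff\<close>)
  then have "C1_on_disc M"
    using D by (intro C1_on_discI)
  moreover have "\<exists>l\<ge>1. ((\<lambda>r. ereal (M (of_real r * \<zeta>))) \<longlongrightarrow> l) (at_left 1)" if \<zeta>: "\<zeta> \<in> E \<union> A" for \<zeta>
  proof (cases "\<zeta> \<in> A")
    case True
    have "((\<lambda>r. (1 - squash \<kappa> (u (of_real r * \<zeta>))) * (1 - v (of_real r * \<zeta>))) \<longlongrightarrow> 0) (at_left 1)"
    proof (rule Lim_null_comparison)
      show "((\<lambda>r. (1 + 2 / arctan \<kappa>) * (1 - v (of_real r * \<zeta>))) \<longlongrightarrow> 0) (at_left (1::real))"
        using tendsto_mult[OF tendsto_const tendsto_diff[OF tendsto_const tendsto_radial[OF v(2), of \<zeta>]], of "1 + 2 / arctan \<kappa>" 1] v(5)[OF True]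
        by simp
      have "\<bar>1 - squash \<kappa> (u (of_real r * \<zeta>))\<bar> * \<bar>1 - v (of_real r * \<zeta>)\<bar> \<le> (1 + 2 / arctan \<kappa>) * (1 - v (of_real r * \<zeta>))" for r
        using bnd[of "u (of_real r * \<zeta>)"] v(3,4)[of "of_real r * \<zeta>"] a by (intro mult_mono) auto
      then show "\<forall>\<^sub>F r in at_left (1::real). norm ((1 - squash \<kappa> (u (of_real r * \<zeta>))) * (1 - v (of_real r * \<zeta>)))
          \<le> (1 + 2 / arctan \<kappa>) * (1 - v (of_real r * \<zeta>))"
        by (simp add: abs_mult)
    qed
    from tendsto_diff[OF tendsto_const this, of 1]
    have "((\<lambda>r. ereal (M (of_real r * \<zeta>))) \<longlongrightarrow> ereal 1) (at_left 1)"
      unfolding M_def by simp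
    then show ?thesis
      by (intro exI[of _ "ereal 1"]) (simp add: one_ereal_def)
  next
    case False
    then obtain l where l: "1 \<le> l" "((\<lambda>r. ereal (u (of_real r * \<zeta>))) \<longlongrightarrow> l) (at_left 1)"
      using u'(3) \<zeta> by blast
    \<comment> \<open>\<open>squash\<close> fixes 1 and is increasing, so it preserves limits at
      least 1, and it turns the permitted limit plus infinity into the finite number
      \<open>pi / 2 / arctan \<kappa>\<close>.\<close>
    have "\<exists>c\<ge>1. ((\<lambda>r. squash \<kappa> (u (of_real r * \<zeta>))) \<longlongrightarrow> c) (at_left 1)"
    proof (cases l)
      case (real x)
      have "isCont (squash \<kappa>) x"
        using h' DERIV_isCont by blast
      moreover have "((\<lambda>r. u (of_real r * \<zeta>)) \<longlongrightarrow> x) (at_left 1)"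
        using l real by simp
      ultimately have "((\<lambda>r. squash \<kappa> (u (of_real r * \<zeta>))) \<longlongrightarrow> squash \<kappa> x) (at_left 1)"
        by (rule isCont_tendsto_compose)
      moreover have "1 \<le> squash \<kappa> x"
      proof -
        have "\<kappa> * 1 \<le> \<kappa> * x"
          using l real \<kappa> by (intro mult_left_mono) auto
        then have "arctan \<kappa> \<le> arctan (\<kappa> * x)"
          by (simp add: arctan_le_iff)
        then show ?thesis
          using a by (simp add: squash_def)
      qed
      ultimately show ?thesis by blast
    next
      case PInf
      then have "filterlim (\<lambda>r. u (of_real r * \<zeta>)) at_top (at_left 1)"
        using l(2) by (simp add: tendsto_PInfty_eq_at_top)
      then have "filterlim (\<lambda>r. \<kappa> * u (of_real r * \<zeta>)) at_top (at_left 1)"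
        by (rule filterlim_tendsto_pos_mult_at_top[OF tendsto_const \<kappa>])
      then have "((\<lambda>r. arctan (\<kappa> * u (of_real r * \<zeta>))) \<longlongrightarrow> pi / 2) (at_left 1)"
        by (rule filterlim_compose[OF tendsto_arctan_at_top])
      then have "((\<lambda>r. squash \<kappa> (u (of_real r * \<zeta>))) \<longlongrightarrow> pi / 2 / arctan \<kappa>) (at_left 1)"
        unfolding squash_def using a by (intro tendsto_divide tendsto_const) auto
      moreover have "1 \<le> pi / 2 / arctan \<kappa>"
        using a arctan_ubound[of \<kappa>] by (simp add: field_simps)
      ultimately show ?thesis by blast
    next
      case MInf
      then show ?thesis using l by simp
    qed
    then obtain c where c: "1 \<le> c" "((\<lambda>r. squash \<kappa> (u (of_real r * \<zeta>))) \<longlongrightarrow> c) (at_left 1)" by blast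
    have "((\<lambda>r. ereal (M (of_real r * \<zeta>))) \<longlongrightarrow> ereal (1 - (1 - c) * (1 - v \<zeta>))) (at_left 1)"
      unfolding M_def by (intro tendsto_intros c tendsto_radial v)
    moreover have "1 \<le> ereal (1 - (1 - c) * (1 - v \<zeta>))"
      using c v(4)[of \<zeta>] by (simp add: one_ereal_def mult_nonpos_nonneg)
    ultimately show ?thesis by blast
  qed
  moreover have "M z \<le> 0" if z: "z \<in> F" for z
  proof -
    have "\<kappa> * u z \<le> 0"
      using u'(2)[OF z] \<kappa> by (simp add: mult_nonneg_nonpos)
    then have "squash \<kappa> (u z) \<le> 0"
      unfolding squash_def using a by (intro divide_nonpos_pos) auto
    then show ?thesis
      using v(6)[OF z] by (simp add: M_def)
  qed
  ultimately have "condenser_admissible (E \<union> A) F M"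
    using sub by (subst condenser_admissible_iff) auto
  then have "condenser_cap (E \<union> A) F \<le> dirichlet_energy M"
    by (rule condenser_cap_le)
  also have "\<dots> \<le> (\<integral>\<^sup>+z. ennreal ((1 + \<eta>) * (\<kappa> / arctan \<kappa>)\<^sup>2) * (ennreal ((norm (gradient u z))\<^sup>2) * indicator (ball 0 1) z)
     + ennreal ((1 + 1 / \<eta>) * (1 + 2 / arctan \<kappa>)\<^sup>2) * (ennreal ((norm (gradient v z))\<^sup>2) * indicator (ball 0 1) z) \<partial>lborel)"
    unfolding dirichlet_energy_def
  proof (intro nn_integral_mono)
    fix z :: complex
    have "ennreal ((norm (gradient M z))\<^sup>2) \<le> ennreal ((1 + \<eta>) * (\<kappa> / arctan \<kappa>)\<^sup>2) * ennreal ((norm (gradient u z))\<^sup>2)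
     + ennreal ((1 + 1 / \<eta>) * (1 + 2 / arctan \<kappa>)\<^sup>2) * ennreal ((norm (gradient v z))\<^sup>2)" if z: "z \<in> ball 0 1"
    proof -
      have "(norm (D z))\<^sup>2 \<le> (1 + \<eta>) * (norm (((1 - v z) * h' (u z)) *\<^sub>R gradient u z))\<^sup>2
          + (1 + 1 / \<eta>) * (norm ((1 - squash \<kappa> (u z)) *\<^sub>R gradient v z))\<^sup>2"
        unfolding D_def by (rule power2_norm_add_le[OF \<eta>])
      also have "\<dots> \<le> (1 + \<eta>) * (\<kappa> / arctan \<kappa> * norm (gradient u z))\<^sup>2
          + (1 + 1 / \<eta>) * ((1 + 2 / arctan \<kappa>) * norm (gradient v z))\<^sup>2"
      proof (intro add_mono mult_left_mono power_mono)
        have "\<bar>1 - v z\<bar> * \<bar>h' (u z)\<bar> \<le> 1 * (\<kappa> / arctan \<kappa>)"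
          using v(3,4)[of z] h'_bnd[of "u z"] by (intro mult_mono) auto
        then show "norm (((1 - v z) * h' (u z)) *\<^sub>R gradient u z) \<le> \<kappa> / arctan \<kappa> * norm (gradient u z)"
          unfolding norm_scaleR abs_mult by (intro mult_right_mono) auto
        have "\<bar>1 - squash \<kappa> (u z)\<bar> \<le> 1 + 2 / arctan \<kappa>"
          using bnd[of "u z"] by linarith
        then show "norm ((1 - squash \<kappa> (u z)) *\<^sub>R gradient v z) \<le> (1 + 2 / arctan \<kappa>) * norm (gradient v z)"
          unfolding norm_scaleR by (intro mult_right_mono) auto
      qed (use \<eta> in auto)
      also have "\<dots> = (1 + \<eta>) * (\<kappa> / arctan \<kappa>)\<^sup>2 * (norm (gradient u z))\<^sup>2
          + (1 + 1 / \<eta>) * (1 + 2 / arctan \<kappa>)\<^sup>2 * (norm (gradient v z))\<^sup>2"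
        by (simp only: power_mult_distrib mult.assoc)
      finally have "ennreal ((norm (gradient M z))\<^sup>2) \<le> ennreal ((1 + \<eta>) * (\<kappa> / arctan \<kappa>)\<^sup>2 * (norm (gradient u z))\<^sup>2
          + (1 + 1 / \<eta>) * (1 + 2 / arctan \<kappa>)\<^sup>2 * (norm (gradient v z))\<^sup>2)"
        unfolding gradient_eqI[OF D[OF z]] by (rule ennreal_leI)
      also have "\<dots> = ennreal ((1 + \<eta>) * (\<kappa> / arctan \<kappa>)\<^sup>2 * (norm (gradient u z))\<^sup>2)
          + ennreal ((1 + 1 / \<eta>) * (1 + 2 / arctan \<kappa>)\<^sup>2 * (norm (gradient v z))\<^sup>2)"
        using \<eta> by (intro ennreal_plus) auto
      also have "\<dots> = ennreal ((1 + \<eta>) * (\<kappa> / arctan \<kappa>)\<^sup>2) * ennreal ((norm (gradient u z))\<^sup>2)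
          + ennreal ((1 + 1 / \<eta>) * (1 + 2 / arctan \<kappa>)\<^sup>2) * ennreal ((norm (gradient v z))\<^sup>2)"
        using \<eta> by (subst (1 2) ennreal_mult) auto
      finally show ?thesis .
    qed
    then show "ennreal ((norm (gradient M z))\<^sup>2) * indicator (ball 0 1) z \<le>
        ennreal ((1 + \<eta>) * (\<kappa> / arctan \<kappa>)\<^sup>2) * (ennreal ((norm (gradient u z))\<^sup>2) * indicator (ball 0 1) z)
     + ennreal ((1 + 1 / \<eta>) * (1 + 2 / arctan \<kappa>)\<^sup>2) * (ennreal ((norm (gradient v z))\<^sup>2) * indicator (ball 0 1) z)"
      by (cases "z \<in> ball 0 1") auto
  qed
  also have "\<dots> = ennreal ((1 + \<eta>) * (\<kappa> / arctan \<kappa>)\<^sup>2) * dirichlet_energy u +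
    ennreal ((1 + 1 / \<eta>) * (1 + 2 / arctan \<kappa>)\<^sup>2) * dirichlet_energy v"
    unfolding dirichlet_energy_def
    using borel_measurable_gradient_sq[OF u'(1)] borel_measurable_gradient_sq[OF v(1)]
    by (subst nn_integral_add) (auto simp: nn_integral_cmult)
  finally show ?thesis .
qed

text \<open>\<open>\<kappa> / arctan \<kappa>\<close> is the largest slope of
  \<open>squash \<kappa>\<close> and tends to 1 as \<kappa> tends to 0. The factor
  \<open>1 + \<kappa>\<close> is the one from Young's inequality: a single small parameter serves
  both purposes.\<close>

lemma squash_slope_near_1:
  assumes "1 < (c::real)"
  shows "\<exists>\<kappa>>0. (1 + \<kappa>) * (\<kappa> / arctan \<kappa>)\<^sup>2 \<le> c"
proof -
  have "((\<lambda>h. arctan h / h) \<longlongrightarrow> 1) (at (0::real))"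
    using DERIV_arctan[of 0] by (simp add: DERIV_def)
  then have "((\<lambda>h. (1 + h) * (inverse (arctan h / h))\<^sup>2) \<longlongrightarrow> (1 + 0) * (inverse 1)\<^sup>2) (at (0::real))"
    by (intro tendsto_intros) auto
  then have "((\<lambda>h. (1 + h) * (h / arctan h)\<^sup>2) \<longlongrightarrow> 1) (at_right (0::real))"
    by (auto intro: filterlim_mono at_le)
  then have "eventually (\<lambda>h. (1 + h) * (h / arctan h)\<^sup>2 < c) (at_right 0)"
    using assms by (rule order_tendstoD)
  moreover have "eventually (\<lambda>h. h > 0) (at_right (0::real))"
    by (rule eventually_at_right_less)
  ultimately have "eventually (\<lambda>h. h > 0 \<and> (1 + h) * (h / arctan h)\<^sup>2 \<le> c) (at_right (0::real))"
    by eventually_elim simp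
  then show ?thesis
    using eventually_happens'[of "at_right (0::real)"] by force
qed

text \<open>\<open>B\<close> depends on \<open>c\<close> only. Therefore a cutoff \<open>v\<close>
  with energy small compared with \<open>1 / B\<close> can be chosen afterwards, uniformly in
  \<open>E\<close>.\<close>

lemma condenser_cap_Un_le:
  assumes "1 < c"
  obtains B where "B \<ge> 0" "\<And>E A F v. E \<subseteq> sphere 0 1 \<Longrightarrow> A \<subseteq> sphere 0 1 \<Longrightarrow> F \<subseteq> ball 0 1 \<Longrightarrow>
    C1_on_disc v \<Longrightarrow> continuous_on UNIV v \<Longrightarrow> (\<And>z. 0 \<le> v z) \<Longrightarrow> (\<And>z. v z \<le> 1) \<Longrightarrow>
    (\<And>z. z \<in> A \<Longrightarrow> v z = 1) \<Longrightarrow> (\<And>z. z \<in> F \<Longrightarrow> v z = 0) \<Longrightarrow>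
    condenser_cap (E \<union> A) F \<le> ennreal c * condenser_cap E F + ennreal B * dirichlet_energy v"
proof -
  obtain \<kappa> where \<kappa>: "\<kappa> > 0" "(1 + \<kappa>) * (\<kappa> / arctan \<kappa>)\<^sup>2 \<le> c"
    using squash_slope_near_1[OF assms] by blast
  define B where "B = (1 + 1 / \<kappa>) * (1 + 2 / arctan \<kappa>)\<^sup>2"
  show ?thesis
  proof (rule that[of B])
    show "B \<ge> 0" using \<kappa> by (simp add: B_def)
    fix E A F :: "complex set" and v
    assume *: "E \<subseteq> sphere 0 1" "A \<subseteq> sphere 0 1" "F \<subseteq> ball 0 1"
      "C1_on_disc v" "continuous_on UNIV v" "\<And>z. 0 \<le> v z" "\<And>z. v z \<le> 1"
      "\<And>z. z \<in> A \<Longrightarrow> v z = 1" "\<And>z. z \<in> F \<Longrightarrow> v z = 0"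
    let ?Y = "ennreal B * dirichlet_energy v"
    have le: "condenser_cap (E \<union> A) F \<le> ennreal c * dirichlet_energy u + ?Y" if "condenser_admissible E F u" for u
    proof -
      have "condenser_cap (E \<union> A) F \<le> ennreal ((1 + \<kappa>) * (\<kappa> / arctan \<kappa>)\<^sup>2) * dirichlet_energy u + ?Y"
        unfolding B_def by (rule condenser_cap_Un_le_squash[OF \<kappa>(1) \<kappa>(1) *(1,2,3) that *(4-9)])
      also have "\<dots> \<le> ennreal c * dirichlet_energy u + ?Y"
        using \<kappa> by (intro add_right_mono mult_right_mono ennreal_leI) auto
      finally show ?thesis .
    qed
    show "condenser_cap (E \<union> A) F \<le> ennreal c * condenser_cap E F + ?Y"
    \<comment> \<open>Only a finite right side matters. Then the infimum is finite too and has a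
      competitor within \<open>e / c\<close>, an error that \<open>c\<close> turns into
      \<open>e\<close>.\<close>
    proof (rule ennreal_le_epsilon)
      fix e :: real
      assume fin: "ennreal c * condenser_cap E F + ?Y < top" and "0 < e"
      then have fin: "condenser_cap E F < top"
        using assms by (auto simp: ennreal_mult_less_top ennreal_eq_0_iff)
      have "condenser_cap E F < condenser_cap E F + ennreal (e / c)"
        using fin \<open>0 < e\<close> assms
        by (cases "condenser_cap E F") (auto simp: ennreal_less_iff simp flip: ennreal_plus)
      then obtain u where u: "condenser_admissible E F u" "dirichlet_energy u < condenser_cap E F + ennreal (e / c)"
        unfolding condenser_cap_def by (auto simp: INF_less_iff)
      have "condenser_cap (E \<union> A) F \<le> ennreal c * dirichlet_energy u + ?Y"
        by (rule le[OF u(1)])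
      also have "\<dots> \<le> ennreal c * (condenser_cap E F + ennreal (e / c)) + ?Y"
        using u by (intro add_right_mono mult_left_mono) auto
      also have "\<dots> = ennreal c * condenser_cap E F + ?Y + ennreal e"
        using assms \<open>0 < e\<close> by (simp add: distrib_left add_ac flip: ennreal_mult')
      finally show "condenser_cap (E \<union> A) F \<le> ennreal c * condenser_cap E F + ?Y + ennreal e" .
    qed
  qed
qed

text \<open>The supremum \<open>T\<close> works: points of \<open>S\<close> close to
  \<open>T\<close> bound \<open>f T\<close> from above, and if \<open>f T\<close> were less than
  \<epsilon>, a point beyond \<open>T\<close> would belong to \<open>S\<close>. The factor
  \<open>c\<close> is harmless because \<open>step\<close> is only applied where the value is at
  most \<epsilon>.\<close>

lemma ennreal_IVT_mono:
  fixes f :: "real \<Rightarrow> ennreal"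
  assumes mono: "\<And>s t. s \<le> t \<Longrightarrow> f s \<le> f t"
    and step: "\<And>c \<eta>. 1 < c \<Longrightarrow> 0 < \<eta> \<Longrightarrow> \<exists>d>0. \<forall>s t. s \<le> t \<and> t \<le> s + d \<longrightarrow> f t \<le> ennreal c * f s + ennreal \<eta>"
    and ab: "a \<le> b" "f a \<le> ennreal \<epsilon>" "ennreal \<epsilon> \<le> f b" and \<epsilon>: "0 < \<epsilon>"
  shows "\<exists>t. f t = ennreal \<epsilon>"
proof -
  define S where "S = {t \<in> {a..b}. f t \<le> ennreal \<epsilon>}"
  define T where "T = Sup S"
  have S: "a \<in> S" "bdd_above S"
    using ab by (auto simp: S_def intro: bdd_aboveI[of _ b])
  have T: "a \<le> T" "T \<le> b"
    unfolding T_def using S by (auto intro: cSup_upper) (auto simp: S_def intro!: cSup_least)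
  have "f T \<le> ennreal \<epsilon>"
  proof (rule ccontr)
    assume "\<not> ?thesis"
    then obtain z where z: "ennreal \<epsilon> < z" "z < f T"
      using dense[of "ennreal \<epsilon>" "f T"] by (auto simp: not_le)
    then obtain y where "z = ennreal y" "0 \<le> y"
      by (cases z) auto
    with z have y: "ennreal \<epsilon> < ennreal y" "ennreal y < f T" "0 \<le> y"
      by auto
    then have y': "\<epsilon> < y" using \<epsilon> by (simp add: ennreal_less_iff)
    \<comment> \<open>\<open>f T\<close> may be infinite, hence the real \<open>y\<close> in
      between. The factor \<open>1 + \<eta> / \<epsilon>\<close> and the summand \<eta> raise a
      value at most \<epsilon> by at most \<open>2 * \<eta>\<close>, which is exactly the gap to
      \<open>y\<close>.\<close>
    define \<eta> where "\<eta> = (y - \<epsilon>) / 2"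
    have "1 < 1 + \<eta> / \<epsilon>" "0 < \<eta>" using y' \<epsilon> by (auto simp: \<eta>_def)
    from step[OF this] obtain d where d: "d > 0"
      "\<And>s t. s \<le> t \<Longrightarrow> t \<le> s + d \<Longrightarrow> f t \<le> ennreal (1 + \<eta> / \<epsilon>) * f s + ennreal \<eta>" by blast
    obtain s where s: "s \<in> S" "T - d < s"
      using less_cSupD[of S "T - d"] S d by (auto simp: T_def)
    have "s \<le> T" unfolding T_def using s S by (intro cSup_upper)
    then have "f T \<le> ennreal (1 + \<eta> / \<epsilon>) * f s + ennreal \<eta>"
      using s by (intro d) auto
    also have "\<dots> \<le> ennreal (1 + \<eta> / \<epsilon>) * ennreal \<epsilon> + ennreal \<eta>"
      using s by (intro add_right_mono mult_left_mono) (auto simp: S_def)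
    also have "\<dots> = ennreal ((1 + \<eta> / \<epsilon>) * \<epsilon> + \<eta>)"
      using \<open>0 < \<eta>\<close> \<epsilon> by (simp add: ennreal_mult' ennreal_plus)
    also have "(1 + \<eta> / \<epsilon>) * \<epsilon> + \<eta> = y"
      using \<epsilon> by (simp add: \<eta>_def field_simps)
    finally show False using y by simp
  qed
  moreover have "\<not> f T < ennreal \<epsilon>"
  proof
    assume less: "f T < ennreal \<epsilon>"
    then obtain y where y: "f T = ennreal y" "0 \<le> y" "y < \<epsilon>"
      by (cases "f T") (auto simp: ennreal_less_iff)
    define \<eta> where "\<eta> = (\<epsilon> - y) / 2"
    have "1 < 1 + \<eta> / \<epsilon>" "0 < \<eta>" using y \<epsilon> by (auto simp: \<eta>_def)
    from step[OF this] obtain d where d: "d > 0"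
      "\<And>s t. s \<le> t \<Longrightarrow> t \<le> s + d \<Longrightarrow> f t \<le> ennreal (1 + \<eta> / \<epsilon>) * f s + ennreal \<eta>" by blast
    have "T \<noteq> b" using less ab by auto
    define t where "t = min b (T + d)"
    have t: "T < t" "t \<le> T + d" "t \<le> b" using T \<open>T \<noteq> b\<close> d by (auto simp: t_def)
    have "f t \<le> ennreal (1 + \<eta> / \<epsilon>) * f T + ennreal \<eta>"
      using t by (intro d) auto
    also have "\<dots> = ennreal ((1 + \<eta> / \<epsilon>) * y + \<eta>)"
      using \<open>0 < \<eta>\<close> \<epsilon> y by (simp add: ennreal_mult' ennreal_plus)
    also have "\<dots> \<le> ennreal \<epsilon>"
    proof (rule ennreal_leI)
      have "(\<eta> / \<epsilon>) * y \<le> (\<eta> / \<epsilon>) * \<epsilon>"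
        using y \<epsilon> \<open>0 < \<eta>\<close> by (intro mult_left_mono) auto
      then have "(1 + \<eta> / \<epsilon>) * y \<le> y + \<eta>"
        using \<epsilon> by (simp add: distrib_right)
      moreover have "y + \<eta> + \<eta> = \<epsilon>" by (simp add: \<eta>_def)
      ultimately show "(1 + \<eta> / \<epsilon>) * y + \<eta> \<le> \<epsilon>" by linarith
    qed
    finally have "t \<in> S" using t T by (simp add: S_def)
    then have "t \<le> T" unfolding T_def using S by (intro cSup_upper)
    with t show False by simp
  qed
  ultimately show ?thesis by (auto simp: order.order_iff_strict)
qed

text \<open>Cutting \<open>M\<close> off at a slope \<open>t\<close>, the capacity depends continuously on \<open>t\<close>, since short arcs have
  small capacity.\<close>

lemma circle_cap_intermediate:
  assumes \<epsilon>: "0 < \<epsilon>" and M: "closed M" "M \<subseteq> {0..1}"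
    and le: "ennreal \<epsilon> \<le> circle_cap (slope_pt ` M)"
  obtains E where "closed E" "E \<subseteq> slope_pt ` M" "circle_cap E = ennreal \<epsilon>"
proof -
  define f where "f = (\<lambda>t. circle_cap (slope_pt ` (M \<inter> {..t})))"
  have half: "cball 0 (1/2) \<subseteq> ball (0::complex) 1" by auto
  have sph: "slope_pt ` X \<subseteq> sphere 0 1" for X by auto
  have "\<exists>t. f t = ennreal \<epsilon>"
  proof (rule ennreal_IVT_mono[OF _ _ _ _ _ \<epsilon>])
    show "f s \<le> f t" if "s \<le> t" for s t
      unfolding f_def circle_cap_def using that half sph by (intro condenser_cap_mono) auto
  next
    fix c \<eta> :: real
    assume "1 < c" "0 < \<eta>"
    obtain B where B: "B \<ge> 0" "\<And>E A F v. E \<subseteq> sphere 0 1 \<Longrightarrow> A \<subseteq> sphere 0 1 \<Longrightarrow> F \<subseteq> ball 0 1 \<Longrightarrow>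
      C1_on_disc v \<Longrightarrow> continuous_on UNIV v \<Longrightarrow> (\<And>z. 0 \<le> v z) \<Longrightarrow> (\<And>z. v z \<le> 1) \<Longrightarrow>
      (\<And>z. z \<in> A \<Longrightarrow> v z = 1) \<Longrightarrow> (\<And>z. z \<in> F \<Longrightarrow> v z = 0) \<Longrightarrow>
      condenser_cap (E \<union> A) F \<le> ennreal c * condenser_cap E F + ennreal B * dirichlet_energy v"
      using condenser_cap_Un_le[OF \<open>1 < c\<close>] by blast
    \<comment> \<open>Chosen so that \<open>B\<close> times the energy bound of a bump is at most
      \<eta>.\<close>
    define N where "N = nat \<lceil>B * (128 * pi * exp 2) / \<eta>\<rceil> + 1"
    have N: "1 \<le> N" by (simp add: N_def)
    have "B * (128 * pi * exp 2) / \<eta> \<le> real N"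
      unfolding N_def by linarith
    then have BN: "B * (128 * pi * exp 2 / real N) \<le> \<eta>"
      using \<open>0 < \<eta>\<close> N by (simp add: field_simps)
    \<comment> \<open>The step is the inner radius of a bump with \<open>R = 1 / 2\<close>: points
      with slopes in \<open>{s..t}\<close> lie where it equals 1. This outer radius still lets the
      bump vanish on \<open>cball 0 (1/2)\<close>.\<close>
    have "f t \<le> ennreal c * f s + ennreal \<eta>" if st: "s \<le> t" "t \<le> s + 1 / 2 * exp (- real N)" for s t
    proof -
      let ?v = "bump (slope_pt s) (1/2) N"
      have v1: "?v z = 1" if z: "z \<in> slope_pt ` (M \<inter> {s..t})" for z
      proof -
        obtain m where m: "z = slope_pt m" "s \<le> m" "m \<le> t" using z by auto
        then have "dist z (slope_pt s) \<le> 1 / 2 * exp (- real N)"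
          using dist_slope_pt_le[of m s] st by auto
        then show ?thesis using N by (intro bump_eq_1) auto
      qed
      have v0: "?v z = 0" if "z \<in> cball 0 (1/2)" for z
      proof -
        have "norm (slope_pt s) \<le> norm z + dist z (slope_pt s)"
          using norm_triangle_sub[of "slope_pt s" z] by (simp add: dist_norm norm_minus_commute)
        then show ?thesis using that N by (intro bump_eq_0) auto
      qed
      have "f t \<le> condenser_cap (slope_pt ` (M \<inter> {..s}) \<union> slope_pt ` (M \<inter> {s..t})) (cball 0 (1/2))"
        unfolding f_def circle_cap_def
      proof (intro condenser_cap_mono)
        show "slope_pt ` (M \<inter> {..t}) \<subseteq> slope_pt ` (M \<inter> {..s}) \<union> slope_pt ` (M \<inter> {s..t})"
          unfolding image_Un[symmetric] by (intro image_mono) auto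
      qed (use half in auto)
      also have "\<dots> \<le> ennreal c * condenser_cap (slope_pt ` (M \<inter> {..s})) (cball 0 (1/2)) + ennreal B * dirichlet_energy ?v"
        using N v0 v1 half
        by (intro B sph bump_C1_on_disc continuous_on_bump bump_bounds) auto
      also have "\<dots> \<le> ennreal c * f s + ennreal B * ennreal (128 * pi * exp 2 / real N)"
        unfolding f_def circle_cap_def using N
        by (intro add_left_mono mult_left_mono dirichlet_energy_bump_le) auto
      also have "ennreal B * ennreal (128 * pi * exp 2 / real N) = ennreal (B * (128 * pi * exp 2 / real N))"
        by (rule ennreal_mult'[OF B(1), symmetric])
      also have "\<dots> \<le> ennreal \<eta>"
        by (rule ennreal_leI[OF BN])
      finally show ?thesis by (simp add: add_left_mono)
    qed
    then show "\<exists>d>0. \<forall>s t. s \<le> t \<and> t \<le> s + d \<longrightarrow> f t \<le> ennreal c * f s + ennreal \<eta>"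
      by (intro exI[of _ "1 / 2 * exp (- real N)"]) auto
  next
    \<comment> \<open>Cutting at slope -1 leaves the empty set, for which the zero function is
      admissible.\<close>
    have "M \<inter> {..-1} = {}" using M by auto
    moreover have "condenser_admissible {} (cball 0 (1/2)) (\<lambda>_. 0)"
      using half C1_on_discI[of "\<lambda>_. 0" "\<lambda>_. 0"] by (subst condenser_admissible_iff) (auto simp: GDERIV_const)
    then have "condenser_cap {} (cball 0 (1/2)) \<le> dirichlet_energy (\<lambda>_. 0)"
      by (rule condenser_cap_le)
    moreover have "dirichlet_energy (\<lambda>_. 0) = 0"
      unfolding dirichlet_energy_def gradient_eqI[OF GDERIV_const] by simp
    ultimately show "f (-1) \<le> ennreal \<epsilon>"
      by (simp add: f_def circle_cap_def)
  next
    have "M \<inter> {..1} = M" using M by auto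
    then show "ennreal \<epsilon> \<le> f 1"
      using le by (simp add: f_def)
  qed simp
  then obtain t where t: "f t = ennreal \<epsilon>" by blast
  have "compact (M \<inter> {..t})"
    using M by (intro compact_Int_closed) (auto intro: compact_eq_bounded_closed[THEN iffD2] bounded_subset[OF bounded_closed_interval])
  then have "compact (slope_pt ` (M \<inter> {..t}))"
    by (intro compact_continuous_image continuous_intros)
  then show ?thesis
    using t by (intro that[of "slope_pt ` (M \<inter> {..t})"]) (auto simp: f_def compact_imp_closed)
qed

text \<open>The cutoffs have outer radius \<open>1 / (8 * n)\<close>, which separates them because
  neighbouring centres are at least \<open>1 / (2 * n)\<close> apart, and \<open>d\<close> is their
  inner radius for \<open>N = n\<close>. The total energy bound
  \<open>n * (128 * pi * exp 2 / n)\<close> is free of \<open>n\<close>. From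
  \<open>1 + ln (1 / d) = 1 + ln (8 * n) + n \<le> 9 * n\<close> one may take \<open>K = 10\<close>,
  and \<open>160 = 16 * K\<close>.\<close>

lemma arc_family:
  fixes n :: nat
  assumes r: "0 < r" "r < 1" and n: "1 \<le> n" "1 / (8 * real n) \<le> 1 - r"
  defines "d \<equiv> 1 / (8 * real n) * exp (- real n)"
  defines "M \<equiv> \<Union>k<n. {real k / real n..real k / real n + d}"
  shows "closed M" "M \<subseteq> {0..1}" "ennreal (1 / 160) \<le> circle_cap (slope_pt ` M)"
    "E \<subseteq> slope_pt ` M \<Longrightarrow> condenser_cap E (cball 0 r) \<le> ennreal (128 * pi * exp 2)"
proof -
  have n': "1 \<le> real n" using n by simp
  have d0: "0 < d" using n' by (simp add: d_def)
  have "d \<le> 1 / (8 * real n) * 1"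
    unfolding d_def by (intro mult_left_mono) auto
  then have d: "d \<le> 1 / (8 * real n)" by simp
  have "1 / (8 * real n) \<le> 1 / 8" using n' by simp
  with d have d2: "d \<le> 1 / 2" by linarith
  have nd: "real n * d \<le> 1"
    using mult_left_mono[OF d, of "real n"] n' by simp
  show "closed M" unfolding M_def by (intro closed_UN) auto
  show sub: "M \<subseteq> {0..1}"
  proof
    fix m assume "m \<in> M"
    then obtain k where k: "k < n" "real k / real n \<le> m" "m \<le> real k / real n + d"
      by (auto simp: M_def)
    have "real k / real n + d \<le> (real k + 1) / real n"
      using nd n' by (simp add: field_simps)
    also have "\<dots> \<le> 1" using k by simp
    finally have "real k / real n + d \<le> 1" .
    moreover have "0 \<le> real k / real n" by simp
    ultimately show "m \<in> {0..1}" using k unfolding atLeastAtMost_iff by linarith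
  qed
  show "ennreal (1 / 160) \<le> circle_cap (slope_pt ` M)"
    unfolding circle_cap_def condenser_cap_def
  proof (rule INF_greatest)
    fix u assume "u \<in> {u. condenser_admissible (slope_pt ` M) (cball 0 (1/2)) u}"
    then have u: "condenser_admissible (slope_pt ` M) (cball 0 (1/2)) u" by simp
    have "ln (1 / d) = ln (8 * real n * exp (real n))"
      by (simp add: d_def exp_minus field_simps)
    also have "\<dots> = ln (8 * real n) + real n"
      using n' by (simp add: ln_mult)
    also have "ln (8 * real n) \<le> 8 * real n - 1"
      using n' by (intro ln_le_minus_one) simp
    finally have "1 + ln (1 / d) \<le> 9 * real n" by simp
    then have "(1 + ln (1 / d)) / real n \<le> 9"
      using n' by (simp add: field_simps)
    then have "(1 + ln (1 / d)) / real n + 1 / 2 \<le> 10" by linarith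
    from dirichlet_energy_ge[OF n(1) d0 nd d2 this u[unfolded M_def]]
    show "ennreal (1 / 160) \<le> dirichlet_energy u" by simp
  qed
  show "condenser_cap E (cball 0 r) \<le> ennreal (128 * pi * exp 2)" if E: "E \<subseteq> slope_pt ` M"
  proof -
    have "condenser_cap E (cball 0 r) \<le> ennreal (real n * (128 * pi * exp 2 / real n))"
    proof (rule condenser_cap_separated_le[where R = "1 / (8 * real n)" and P = "\<lambda>k. slope_pt (real k / real n)"])
      show "2 * (1 / (8 * real n)) \<le> dist (slope_pt (real j / real n)) (slope_pt (real k / real n))"
        if "j < n" "k < n" "j \<noteq> k" for j k
      proof -
        have "1 \<le> \<bar>real j - real k\<bar>" using that by linarith
        then have "1 / real n \<le> \<bar>real j - real k\<bar> / real n"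
          by (intro divide_right_mono) auto
        also have "\<dots> = \<bar>real j / real n - real k / real n\<bar>"
          by (simp flip: diff_divide_distrib)
        finally have sep: "1 / real n \<le> \<bar>real j / real n - real k / real n\<bar>" .
        have "2 * (1 / (8 * real n)) \<le> 1 / real n / 2"
          using n' by (simp add: field_simps)
        also have "\<dots> \<le> \<bar>real j / real n - real k / real n\<bar> / 2"
          using sep by (rule divide_right_mono) simp
        also have "\<dots> \<le> dist (slope_pt (real j / real n)) (slope_pt (real k / real n))"
          using that by (intro dist_slope_pt_ge) auto
        finally show ?thesis .
      qed
      show "E \<subseteq> (\<Union>k<n. cball (slope_pt (real k / real n)) (1 / (8 * real n) * exp (- real n)))"
      proof
        fix z assume "z \<in> E"
        then obtain k m where km: "z = slope_pt m" "k < n" "real k / real n \<le> m" "m \<le> real k / real n + d"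
          using E by (auto simp: M_def)
        then have "dist (slope_pt (real k / real n)) z \<le> d"
          using dist_slope_pt_le[of "real k / real n" m] by auto
        with km show "z \<in> (\<Union>k<n. cball (slope_pt (real k / real n)) (1 / (8 * real n) * exp (- real n)))"
          unfolding d_def by auto
      qed
      show "E \<subseteq> sphere 0 1" using E by auto
    qed (use n r in auto)
    then show ?thesis using n' by simp
  qed
qed

theorem theorem2:
  "\<exists>\<epsilon>\<^sub>0::real. \<epsilon>\<^sub>0 > 0 \<and>
     (\<forall>\<epsilon>::real. 0 < \<epsilon> \<and> \<epsilon> < \<epsilon>\<^sub>0 \<longrightarrow>
       (\<exists>C::real. C > 0 \<and>
         (\<forall>r::real. 0 < r \<and> r < 1 \<longrightarrow>
           (\<exists>E. closed E \<and> E \<subseteq> sphere (0::complex) 1 \<and>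
                circle_cap E = ennreal \<epsilon> \<and>
                condenser_cap E (cball 0 r) \<le> ennreal C))))"
proof -
  have main: "\<exists>E. closed E \<and> E \<subseteq> sphere (0::complex) 1 \<and> circle_cap E = ennreal \<epsilon> \<and>
      condenser_cap E (cball 0 r) \<le> ennreal (128 * pi * exp 2)"
    if \<epsilon>: "0 < \<epsilon>" "\<epsilon> < 1 / 160" and r: "0 < r" "r < 1" for \<epsilon> r :: real
  proof -
    \<comment> \<open>Enough arcs for the cutoff radius \<open>1 / (8 * n)\<close> to be at most
      \<open>1 - r\<close>, so that the cutoffs vanish on \<open>cball 0 r\<close>.\<close>
    define n where "n = nat \<lceil>1 / (1 - r)\<rceil>"
    have "1 / (1 - r) \<le> real n" "0 < 1 / (1 - r)"
      using r unfolding n_def by (linarith, simp)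
    then have n: "1 \<le> n" by linarith
    have "1 / (8 * real n) \<le> 1 / real n"
      using n by (simp add: field_simps)
    also have "\<dots> \<le> 1 - r"
      using \<open>1 / (1 - r) \<le> real n\<close> r n by (simp add: field_simps)
    finally have n2: "1 / (8 * real n) \<le> 1 - r" .
    note arcs = arc_family[OF r n n2]
    have "ennreal \<epsilon> \<le> ennreal (1 / 160)"
      using \<epsilon> by (intro ennreal_leI) simp
    from circle_cap_intermediate[OF \<epsilon>(1) arcs(1,2) order_trans[OF this arcs(3)]]
    obtain E where E: "closed E"
      "E \<subseteq> slope_pt ` (\<Union>k<n. {real k / real n..real k / real n + 1 / (8 * real n) * exp (- real n)})"
      "circle_cap E = ennreal \<epsilon>" by blast
    then show ?thesis
      using arcs(4)[OF E(2)] by (intro exI[of _ E]) auto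
  qed
  have "0 < 128 * pi * exp 2"
    by simp
  \<comment> \<open>The constant chosen for the second capacity is the same for all \<epsilon> below
    \<open>1 / 160\<close>.\<close>
  with main show ?thesis
    by (intro exI[of _ "1 / 160 :: real"] conjI allI impI exI[of _ "128 * pi * exp 2"]) auto
qed

end
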